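(* Let $\alpha > -1$ be a real number. Let $S:[0,\infty)\to\mathbb{R}$ be defined by $S(x)=0$ for $0\le x<1$ and $S(x)=1$ for $x\ge 1$. For $n\ge 0$ let $$\Pi_n^{(\alpha)}(S)(x)=\sum_{j=0}^n \hat{s}_j^{(\alpha)}\,L_j^{(\alpha)}(x)$$ be the degree-$n$ expansion of $S$ in the generalized Laguerre polynomials $\{L_j^{(\alpha)}\}_{j=0}^\infty$. Let $x_{n,+}^{(\alpha)}$ be the smallest critical point of $\Pi_n^{(\alpha)}(S)$ that is strictly greater than $1$, and let $x_{n,-}^{(\alpha)}$ be the largest critical point of $\Pi_n^{(\alpha)}(S)$ that is strictly smaller than $1$. Then $$\lim_{n\to\infty}\Big(\Pi_n^{(\alpha)}(S)\big(x_{n,+}^{(\alpha)}\big)-\Pi_n^{(\alpha)}(S)\big(x_{n,-}^{(\alpha)}\big)\Big)=\frac{2}{\pi}\int_0^\pi\frac{\sin t}{t}\,\mathrm{d}t.$$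
   Context: For $\alpha>-1$ the generalized Laguerre polynomials are $$L_n^{(\alpha)}(x)=\sum_{j=0}^n\binom{n+\alpha}{n-j}\frac{(-x)^j}{j!},$$ where $\binom{n+\alpha}{n-j}$ is the generalized binomial coefficient. They are orthogonal on $[0,\infty)$ with respect to the inner product $\langle f,g\rangle=\int_0^\infty f(x)g(x)\,x^\alpha e^{-x}\,\mathrm{d}x$, and $\|f\|^2=\langle f,f\rangle$. The expansion coefficients of $S$ are the orthogonal projection coefficients $$\hat{s}_j^{(\alpha)}=\frac{\langle S,L_j^{(\alpha)}\rangle}{\|L_j^{(\alpha)}\|^2}=\frac{1}{\|L_j^{(\alpha)}\|^2}\int_1^\infty L_j^{(\alpha)}(x)\,x^\alpha e^{-x}\,\mathrm{d}x.$$ A critical point of the polynomial $\Pi_n^{(\alpha)}(S)$ is a real zero of its derivative. The points $x_{n,\pm}^{(\alpha)}$ need not exist for small $n$; the assertion is understood to be that they exist for all sufficiently large $n$ and that the stated limit over such $n$ holds. *)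

theory Defs
  imports "HOL-Analysis.Analysis"
begin

definition laguerre :: "real \<Rightarrow> nat \<Rightarrow> real \<Rightarrow> real" where
  "laguerre \<alpha> n x =
     (\<Sum>j=0..n. ((real n + \<alpha>) gchoose (n - j)) * ((- x) ^ j / fact j))"

text \<open>The endpoint \<open>x = 0\<close>, where \<open>0 powr \<alpha> = 0\<close> by convention, is a null set and does not
  affect the integral.\<close>

definition laguerre_inner :: "real \<Rightarrow> (real \<Rightarrow> real) \<Rightarrow> (real \<Rightarrow> real) \<Rightarrow> real" where
  "laguerre_inner \<alpha> f g = (LINT x:{0..}|lborel. f x * g x * x powr \<alpha> * exp (- x))"

definition laguerre_coeff :: "real \<Rightarrow> (real \<Rightarrow> real) \<Rightarrow> nat \<Rightarrow> real" where
  "laguerre_coeff \<alpha> f j =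
     laguerre_inner \<alpha> f (laguerre \<alpha> j) / laguerre_inner \<alpha> (laguerre \<alpha> j) (laguerre \<alpha> j)"

definition laguerre_expansion :: "real \<Rightarrow> nat \<Rightarrow> (real \<Rightarrow> real) \<Rightarrow> real \<Rightarrow> real" where
  "laguerre_expansion \<alpha> n f x = (\<Sum>j=0..n. laguerre_coeff \<alpha> f j * laguerre \<alpha> j x)"

text \<open>Only the values on \<open>[0, \<infinity>)\<close> enter the coefficients; the value \<open>0\<close> at negative arguments
  is immaterial.\<close>

definition step :: "real \<Rightarrow> real" where
  "step x = (if x < 1 then 0 else 1)"

text \<open>Applied only to polynomial functions, for which \<^const>\<open>deriv\<close> is the true derivative
  everywhere.\<close>

definition critical_point :: "(real \<Rightarrow> real) \<Rightarrow> real \<Rightarrow> bool" where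
  "critical_point p x \<longleftrightarrow> deriv p x = 0"

definition is_x_plus :: "real \<Rightarrow> nat \<Rightarrow> real \<Rightarrow> bool" where
  "is_x_plus \<alpha> n x \<longleftrightarrow>
     1 < x \<and> critical_point (laguerre_expansion \<alpha> n step) x \<and>
     (\<forall>y. 1 < y \<and> critical_point (laguerre_expansion \<alpha> n step) y \<longrightarrow> x \<le> y)"

definition is_x_minus :: "real \<Rightarrow> nat \<Rightarrow> real \<Rightarrow> bool" where
  "is_x_minus \<alpha> n x \<longleftrightarrow>
     x < 1 \<and> critical_point (laguerre_expansion \<alpha> n step) x \<and>
     (\<forall>y. y < 1 \<and> critical_point (laguerre_expansion \<alpha> n step) y \<longrightarrow> y \<le> x)"

text \<open>The points below are unspecified for those \<open>n\<close> for which no such critical point exists.\<close>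

definition x_plus :: "real \<Rightarrow> nat \<Rightarrow> real" where
  "x_plus \<alpha> n = (THE x. is_x_plus \<alpha> n x)"

definition x_minus :: "real \<Rightarrow> nat \<Rightarrow> real" where
  "x_minus \<alpha> n = (THE x. is_x_minus \<alpha> n x)"

end

(*
  With b = alpha + 1, the derivative of the n-th expansion of the step function is
  exp (-1) times the Christoffel-Darboux kernel K(x, 1) of the Laguerre polynomials L_k of
  parameter b, k < n; so the critical points are the zeros of the kernel, and only differences of
  the expansion near x = 1 matter.

  The function u(t) = exp (-t^2/2) t^(b+1/2) L_n(t^2) solves u'' + (lam - t^2 - kap/t^2) u = 0 with
  lam = 4n + 2b + 2 and kap = b^2 - 1/4.  At t = 1 + s / sqrt lam it is a small perturbation of
  v'' + v = 0, and by Christoffel-Darboux the kernel becomes a multiple of sin s / s, uniformly for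
  bounded s.  The multiple is governed by the amplitude lam u(1)^2 + u'(1)^2.  Since the energy
  u'^2 + (lam - t^2 - kap/t^2) u^2 has derivative (-2t + 2 kap/t^3) u^2, this amplitude equals the
  integral of exp (-x) x^(b+1/2) L_n(x)^2 over x > 0 up to lower order terms.  Expanding L_n in
  Laguerre polynomials of parameter b + 1/2 turns the integral into a sum with coefficients
  (1/2 choose m)^2, whose total is 4/pi, and the multiple comes out as 1/pi.  Hence the critical
  points next to 1 sit at s close to +pi and -pi, and the jump tends to the integral of
  sin s / (pi s) over [-pi, pi].
*)

theory Submission
  imports Defs "HOL-Probability.Sinc_Integral" "HOL-Real_Asymp.Real_Asymp"
begin

section \<open>Laguerre polynomials: recurrences and differential equation\<close>

text \<open>The oscillator arrives at t = 1 with a phase that depends on n and is never determined.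
  What the kernel contains is, up to lower order, v(s) v'(0) - v(0) v'(s) for the rescaled solution
  v. For v = A cos (s - phi) this equals A^2 sin s, so phi drops out and only the amplitude A has to
  be found; that is why an integral identity suffices. The integral carries half a power of x more
  than the orthogonality weight of L_n, which forces the passage to the parameter b + 1/2 and
  produces the binomials (1/2 choose m). The sum of their squares is Gauss's value 2F1(-1/2, -1/2;
  1; 1) = Gamma(2) / Gamma(3/2)^2 = 4/pi. It is halved twice on the way to 1/pi: once because sqrt
  (n / lam) tends to 1/2, and once because x - 1 = (t - 1)(t + 1) and the chain rule leave a factor
  t / (t + 1), which is 1/2 at t = 1.\<close>

definition laguerre_poly :: "real \<Rightarrow> nat \<Rightarrow> real poly" where
  "laguerre_poly \<gamma> n =
     (\<Sum>j\<le>n. monom (((real n + \<gamma>) gchoose (n - j)) * (- 1) ^ j / fact j) j)"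

abbreviation laguerre_deriv :: "real \<Rightarrow> nat \<Rightarrow> real \<Rightarrow> real" where
  "laguerre_deriv \<gamma> n x \<equiv> poly (pderiv (laguerre_poly \<gamma> n)) x"

lemma coeff_laguerre_poly:
  "coeff (laguerre_poly \<gamma> n) j =
     (if j \<le> n then ((real n + \<gamma>) gchoose (n - j)) * (- 1) ^ j / fact j else 0)"
  by (simp add: laguerre_poly_def coeff_sum)

lemma laguerre_eq_poly: "laguerre \<gamma> n x = poly (laguerre_poly \<gamma> n) x"
  unfolding laguerre_def laguerre_poly_def
  by (simp add: poly_sum poly_monom atLeast0AtMost power_minus[of x] mult.assoc)

lemma laguerre_has_real_derivative:
  "(laguerre \<gamma> n has_real_derivative laguerre_deriv \<gamma> n x) (at x)"
  unfolding laguerre_eq_poly[abs_def] by (rule poly_DERIV)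

lemma laguerre_0 [simp]: "laguerre \<gamma> 0 x = 1"
  by (simp add: laguerre_def)

lemma pderiv_laguerre_poly_0 [simp]: "pderiv (laguerre_poly \<gamma> 0) = 0"
  by (simp add: laguerre_poly_def monom_0 pderiv_pCons)

text \<open>Lowering the degree by one while raising \<gamma> by one keeps the upper entry of every
  binomial coefficient. This is what takes the derivative of the expansion with parameter \<alpha>
  into the family with parameter \<alpha> + 1.\<close>

lemma pderiv_laguerre_poly_Suc:
  "pderiv (laguerre_poly \<gamma> (Suc n)) = - laguerre_poly (\<gamma> + 1) n"
proof (rule poly_eqI)
  fix j
  have eq: "real (Suc n) + \<gamma> = real n + (\<gamma> + 1)" by simp
  show "coeff (pderiv (laguerre_poly \<gamma> (Suc n))) j = coeff (- laguerre_poly (\<gamma> + 1) n) j"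
    by (simp add: coeff_pderiv coeff_laguerre_poly eq del: of_nat_Suc)
qed

lemma laguerre_deriv_Suc: "laguerre_deriv \<gamma> (Suc n) x = - laguerre (\<gamma> + 1) n x"
  by (simp add: pderiv_laguerre_poly_Suc laguerre_eq_poly)

text \<open>Coefficientwise this is the absorption identity k (a choose k) = a (a - 1 choose k - 1).
  It trades the derivative of degree n + 1 for values of degrees n and n + 1.\<close>

lemma x_laguerre_deriv_Suc:
  "x * laguerre_deriv \<gamma> (Suc n) x =
     real (Suc n) * laguerre \<gamma> (Suc n) x - (real (Suc n) + \<gamma>) * laguerre \<gamma> n x"
proof -
  have "pCons 0 (pderiv (laguerre_poly \<gamma> (Suc n))) =
     smult (real (Suc n)) (laguerre_poly \<gamma> (Suc n))
       - smult (real (Suc n) + \<gamma>) (laguerre_poly \<gamma> n)" (is "?l = ?r")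
  proof (rule poly_eqI)
    fix j
    have absorb: "real (Suc (n - j)) * ((real (Suc n) + \<gamma>) gchoose (Suc (n - j))) =
        (real (Suc n) + \<gamma>) * ((real n + \<gamma>) gchoose (n - j))"
      using gbinomial_absorption[of "n - j" "real (Suc n) + \<gamma>"] by (simp add: algebra_simps)
    consider "j = 0" | i where "j = Suc i" "j \<le> n" | "j = Suc n" | i where "j = Suc i" "j > Suc n"
      using linorder_less_linear[of j "Suc n"] by (cases j) auto
    then show "coeff ?l j = coeff ?r j"
    proof cases
      case 1
      have "coeff (laguerre_poly \<gamma> (Suc n)) j = ((real (Suc n) + \<gamma>) gchoose (Suc (n - j)))"
        "coeff (laguerre_poly \<gamma> n) j = ((real n + \<gamma>) gchoose (n - j))"
        "real (Suc n) = real (Suc (n - j))"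
        using 1 by (simp_all only: coeff_laguerre_poly) simp_all
      then have "coeff ?r j = 0"
        using absorb by (simp only: coeff_diff coeff_smult)
      then show ?thesis by (simp add: 1)
    next
      case (2 i)
      define A where "A = ((real n + \<gamma>) gchoose (n - j))"
      define B where "B = ((real (Suc n) + \<gamma>) gchoose Suc (n - j))"
      define c where "c = (- 1) ^ j / (fact j :: real)"
      have e: "Suc n - j = Suc (n - j)" and r: "real (Suc (n - j)) = real (Suc n) - real j"
        using 2 by auto
      have "(real (Suc n) - real j) * B = (real (Suc n) + \<gamma>) * A"
        using absorb unfolding r A_def B_def .
      then have "(real j * B) * c = (real (Suc n) * B - (real (Suc n) + \<gamma>) * A) * c"
        by (simp add: algebra_simps)
      moreover have "coeff ?l j = real j * coeff (laguerre_poly \<gamma> (Suc n)) j"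
        using 2 by (simp add: coeff_pderiv)
      moreover have "coeff (laguerre_poly \<gamma> (Suc n)) j = B * c" "coeff (laguerre_poly \<gamma> n) j = A * c"
        using 2 e by (simp_all add: coeff_laguerre_poly A_def B_def c_def)
      ultimately show ?thesis by (simp only: coeff_diff coeff_smult left_diff_distrib mult.assoc)
    qed (auto simp: coeff_pderiv coeff_laguerre_poly)
  qed
  from arg_cong[OF this, of "\<lambda>p. poly p x"] show ?thesis
    unfolding laguerre_eq_poly poly_smult poly_diff poly_pCons by simp
qed

text \<open>Pascal's rule followed by absorption, compared coefficientwise. Here the derivative is
  taken at degree n, in \<open>x_laguerre_deriv_Suc\<close> at degree n + 1; eliminating degree n +
  1 between the two gives the differential equation.\<close>

lemma laguerre_Suc:
  "real (Suc n) * laguerre \<gamma> (Suc n) x =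
     x * laguerre_deriv \<gamma> n x + (real (Suc n) + \<gamma> - x) * laguerre \<gamma> n x"
proof -
  have "smult (real (Suc n)) (laguerre_poly \<gamma> (Suc n)) =
     pCons 0 (pderiv (laguerre_poly \<gamma> n)) + smult (real (Suc n) + \<gamma>) (laguerre_poly \<gamma> n)
     - pCons 0 (laguerre_poly \<gamma> n)" (is "?l = ?r")
  proof (rule poly_eqI)
    fix j
    have pascal: "(real (Suc n) + \<gamma>) gchoose Suc k = ((real n + \<gamma>) gchoose k) + ((real n + \<gamma>) gchoose Suc k)" for k
      using gbinomial_Suc_Suc[of "real n + \<gamma>" k] by (simp add: algebra_simps)
    have absorb: "real (Suc (n - j)) * ((real n + \<gamma>) gchoose (Suc (n - j))) =
        (real n + \<gamma> - real (n - j)) * ((real n + \<gamma>) gchoose (n - j))"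
      using gbinomial_mult_1[of "real n + \<gamma>" "n - j"] by (simp add: algebra_simps)
    consider "j = 0" | i where "j = Suc i" "j \<le> n" | "j = Suc n" | "j > Suc n"
      using linorder_less_linear[of j "Suc n"] by (cases j) auto
    then show "coeff ?l j = coeff ?r j"
    proof cases
      case 1
      define A where "A = ((real n + \<gamma>) gchoose (n - j))"
      define B where "B = ((real n + \<gamma>) gchoose Suc (n - j))"
      have n: "real (Suc (n - j)) = real (Suc n)" "real (n - j) = real n"
        using 1 by simp_all
      have "coeff (laguerre_poly \<gamma> (Suc n)) j = A + B" "coeff (laguerre_poly \<gamma> n) j = A"
        using 1 pascal[of "n - j"] unfolding A_def B_def coeff_laguerre_poly by simp_all
      moreover have "real (Suc n) * B = \<gamma> * A"
        using absorb unfolding n A_def B_def by simp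
      then have "real (Suc n) * (A + B) = (real (Suc n) + \<gamma>) * A"
        unfolding distrib_left distrib_right by simp
      ultimately have "coeff ?l j = coeff (smult (real (Suc n) + \<gamma>) (laguerre_poly \<gamma> n)) j"
        by (simp only: coeff_smult)
      then show ?thesis by (simp add: 1)
    next
      case (2 i)
      define A where "A = ((real n + \<gamma>) gchoose (n - j))"
      define B where "B = ((real n + \<gamma>) gchoose Suc (n - j))"
      have e: "Suc n - j = Suc (n - j)" "n - i = Suc (n - j)" "real (n - j) = real n - real j"
          using 2 by auto
      have ab: "(real (Suc n) - real j) * B = (\<gamma> + real j) * A"
        using absorb unfolding A_def B_def using e by (simp add: algebra_simps)
      define c where "c = (- 1) ^ j / (fact j :: real)"
      have c': "(- 1) ^ i / (fact i :: real) = - (real j * c)"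
        using 2 by (simp add: c_def)
      have "real (Suc n) * (A + B) = real j * A + (real (Suc n) + \<gamma>) * A + real j * B"
        using ab by (simp add: algebra_simps)
      then have "(real (Suc n) * (A + B)) * c = (real j * A + (real (Suc n) + \<gamma>) * A + real j * B) * c"
        by (rule arg_cong)
      moreover have "coeff (laguerre_poly \<gamma> (Suc n)) j = (A + B) * c"
        "coeff (laguerre_poly \<gamma> n) j = A * c"
        using 2 e pascal[of "n - j"] by (simp_all add: coeff_laguerre_poly A_def B_def c_def)
      moreover have "coeff (laguerre_poly \<gamma> n) i = - (real j * B * c)"
        using 2 e c' by (simp add: coeff_laguerre_poly B_def flip: times_divide_eq_right)
      moreover have "coeff (pCons 0 (pderiv (laguerre_poly \<gamma> n))) j = real j * coeff (laguerre_poly \<gamma> n) j"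
        "coeff (pCons 0 (laguerre_poly \<gamma> n)) j = coeff (laguerre_poly \<gamma> n) i"
        using 2 by (simp_all add: coeff_pderiv)
      ultimately show ?thesis
        by (simp only: coeff_diff coeff_add coeff_smult) (simp add: algebra_simps)
    next
      case 3
      then show ?thesis by (simp add: coeff_laguerre_poly coeff_pderiv del: of_nat_Suc)
    next
      case 4
      then show ?thesis by (cases j) (auto simp: coeff_laguerre_poly coeff_pderiv)
    qed
  qed
  from arg_cong[OF this, of "\<lambda>p. poly p x"] show ?thesis
    by (simp add: laguerre_eq_poly algebra_simps)
qed

lemma laguerre_ode:
  "x * poly (pderiv (pderiv (laguerre_poly \<gamma> n))) x =
     (x - \<gamma> - 1) * laguerre_deriv \<gamma> n x - real n * laguerre \<gamma> n x"
proof -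
  let ?P = "laguerre_poly \<gamma> n" and ?Q = "laguerre_poly \<gamma> (Suc n)"
  have id5: "smult (real (Suc n)) ?Q = [:0, 1:] * pderiv ?P + [:real (Suc n) + \<gamma>, - 1:] * ?P"
  proof (rule poly_ext)
    fix x
    show "poly (smult (real (Suc n)) ?Q) x =
        poly ([:0, 1:] * pderiv ?P + [:real (Suc n) + \<gamma>, - 1:] * ?P) x"
      using laguerre_Suc[of n \<gamma> x] by (simp add: laguerre_eq_poly algebra_simps)
  qed
  have A: "real (Suc n) * poly (pderiv ?Q) x =
      x * poly (pderiv (pderiv ?P)) x + (real (Suc n) + \<gamma> + 1 - x) * poly (pderiv ?P) x - poly ?P x" for x
    using arg_cong[OF id5, of "\<lambda>p. poly (pderiv p) x"]
    by (simp add: pderiv_smult pderiv_mult pderiv_add pderiv_pCons pderiv_minus algebra_simps)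
  have B: "real (Suc n) * (x * poly (pderiv ?Q) x) =
      real (Suc n) * (x * (poly (pderiv ?P) x - poly ?P x))" for x
  proof -
    have "real (Suc n) * (x * poly (pderiv ?Q) x) =
        real (Suc n) * (real (Suc n) * laguerre \<gamma> (Suc n) x - (real (Suc n) + \<gamma>) * laguerre \<gamma> n x)"
      by (simp only: x_laguerre_deriv_Suc)
    also have "\<dots> = real (Suc n) * (x * (poly (pderiv ?P) x - poly ?P x))"
      unfolding laguerre_Suc by (simp add: laguerre_eq_poly algebra_simps)
    finally show ?thesis .
  qed
  let ?R = "[:0, 1:] * pderiv (pderiv ?P) + [:\<gamma> + 1, - 1:] * pderiv ?P + smult (real n) ?P"
  \<comment> \<open>Comparing \<open>A\<close> with \<open>B\<close> gives the equation only after
    multiplication by x; cancelling x in the polynomial ring covers x = 0 as well.\<close>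
  have "[:0, 1:] * ?R = 0"
  proof (rule poly_ext)
    fix x
    have "x * (x * poly (pderiv (pderiv ?P)) x + (\<gamma> + 1 - x) * poly (pderiv ?P) x + real n * poly ?P x)
        = x * (real (Suc n) * poly (pderiv ?Q) x - real (Suc n) * (poly (pderiv ?P) x - poly ?P x))"
      unfolding A by (simp add: algebra_simps)
    also have "\<dots> = 0"
      using B[of x] by (simp add: algebra_simps)
    finally show "poly ([:0, 1:] * ?R) x = poly 0 x"
      by (simp add: laguerre_eq_poly algebra_simps)
  qed
  then have "?R = 0" by simp
  from arg_cong[OF this, of "\<lambda>p. poly p x"] show ?thesis
    by (simp add: laguerre_eq_poly algebra_simps)
qed

section \<open>Integrals with the Laguerre weight\<close>

lemma has_bochner_integral_Gamma:
  assumes "a > (0::real)"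
  shows "has_bochner_integral lborel (\<lambda>x. indicator {0..} x *\<^sub>R (x powr (a - 1) * exp (- x))) (Gamma a)"
proof (rule has_bochner_integral_nn_integral)
  show "(\<integral>\<^sup>+ x. ennreal (indicator {0..} x *\<^sub>R (x powr (a - 1) * exp (- x))) \<partial>lborel) = ennreal (Gamma a)"
    using Gamma_conv_nn_integral_real[OF assms] by (simp add: exp_minus divide_inverse mult.assoc)
qed (use assms in \<open>auto simp: Gamma_real_nonneg\<close>)

lemma power_mult_powr: "x \<ge> 0 \<Longrightarrow> x ^ k * x powr c = (x :: real) powr (c + real k)"
  by (cases "x = 0") (auto simp: powr_add powr_realpow)

lemma tendsto_poly_powr_exp:
  fixes c :: real
  shows "((\<lambda>x. poly p x * x powr c * exp (- x)) \<longlongrightarrow> 0) at_top"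
proof -
  have mono: "((\<lambda>x. x powr d * exp (- x)) \<longlongrightarrow> 0) at_top" for d :: real
    by real_asymp
  have "((\<lambda>x. \<Sum>i\<le>degree p. coeff p i * (x powr (c + real i) * exp (- x))) \<longlongrightarrow> (\<Sum>i\<le>degree p. coeff p i * 0)) at_top"
    by (intro tendsto_intros mono)
  moreover have "\<forall>\<^sub>F x in at_top. (\<Sum>i\<le>degree p. coeff p i * (x powr (c + real i) * exp (- x))) = poly p x * x powr c * exp (- x)"
    using eventually_ge_at_top[of 0]
    by eventually_elim (simp add: poly_altdef sum_distrib_right mult.assoc flip: power_mult_powr)
  ultimately show ?thesis using Lim_transform_eventually by fastforce
qed

lemma set_integrable_poly_powr_exp:
  fixes c :: real
  assumes "c > -1"
  shows "set_integrable lborel {0..} (\<lambda>x. poly p x * x powr c * exp (- x))"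
proof -
  have "set_integrable lborel {0..} (\<lambda>x. \<Sum>i\<le>degree p. coeff p i * (x powr (c + real i) * exp (- x)))"
    unfolding set_integrable_def scaleR_sum_right
  proof (intro Bochner_Integration.integrable_sum set_integrable_mult_right[unfolded set_integrable_def] impI)
    fix i
    have "integrable lborel (\<lambda>x. indicator {0..} x *\<^sub>R (x powr (c + real i + 1 - 1) * exp (- x)))"
      using has_bochner_integral_Gamma[of "c + real i + 1"] assms
      by (intro integrable.intros) auto
    then show "integrable lborel (\<lambda>x. indicator {0..} x *\<^sub>R (x powr (c + real i) * exp (- x)))"
      by simp
  qed
  then show ?thesis
    by (rule set_integrable_cong[THEN iffD1, rotated -1])
       (auto simp: poly_altdef sum_distrib_right mult.assoc simp flip: power_mult_powr)
qed

text \<open>For x at least 1 the power x^c is at most x^|c|, and |c| > -1. The energy identity uses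
  c = \<beta> - 3/2, which can lie below -1.\<close>

lemma set_integrable_poly_powr_exp_1:
  fixes c :: real
  shows "set_integrable lborel {1..} (\<lambda>x. poly p x * x powr c * exp (- x))"
proof -
  have "set_integrable lborel {1..} (\<lambda>x. poly p x * x powr \<bar>c\<bar> * exp (- x))"
    by (rule set_integrable_subset[OF set_integrable_poly_powr_exp[of "\<bar>c\<bar>" p]]) auto
  then show ?thesis
  proof (rule set_integrable_bound)
    have "(\<lambda>x. poly p x) \<in> borel_measurable borel"
      by (intro borel_measurable_continuous_onI continuous_intros)
    then show "set_borel_measurable lborel {1..} (\<lambda>x. poly p x * x powr c * exp (- x))"
      unfolding set_borel_measurable_def by measurable
    show "AE x in lborel. x \<in> {1..} \<longrightarrow>
        norm (poly p x * x powr c * exp (- x)) \<le> norm (poly p x * x powr \<bar>c\<bar> * exp (- x))"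
      by (auto simp: abs_mult intro!: mult_right_mono mult_left_mono powr_mono)
  qed
qed

lemma has_real_derivative_poly_powr_exp:
  fixes c :: real
  assumes "x > 0"
  shows "((\<lambda>x. poly p x * x powr (c + 1) * exp (- x)) has_real_derivative
           poly ([:c + 1, - 1:] * p + [:0, 1:] * pderiv p) x * x powr c * exp (- x)) (at x)"
proof -
  have A: "((\<lambda>x. x powr (c + 1)) has_real_derivative (c + 1) * x powr c) (at x)"
    using has_real_derivative_powr[OF assms, of "c + 1"] by simp
  have B: "((\<lambda>x. exp (- x)) has_real_derivative - exp (- x)) (at x)"
    by (auto intro!: derivative_eq_intros)
  have "x powr (c + 1) = x * x powr c"
    using assms by (simp add: powr_add)
  then show ?thesis
    by (intro DERIV_cong[OF DERIV_mult[OF DERIV_mult[OF poly_DERIV A] B]]) (simp add: algebra_simps)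
qed

text \<open>The antiderivative vanishes at infinity, so only the lower end contributes. The case a =
  0 serves orthogonality, where \<open>0 powr (c + 1)\<close> is 0; the case a = 1 serves the step
  coefficients and the energy at t = 1.\<close>

lemma LINT_poly_powr_exp_derivative:
  fixes a c :: real
  assumes "a = 0 \<and> c > -1 \<or> a \<ge> 1"
  shows "(LINT x:{a..}|lborel. poly ([:c + 1, - 1:] * p + [:0, 1:] * pderiv p) x * x powr c * exp (- x))
    = - (poly p a * a powr (c + 1) * exp (- a))"
proof -
  let ?F = "\<lambda>x. poly p x * x powr (c + 1) * exp (- x)"
  let ?f = "\<lambda>x. poly ([:c + 1, - 1:] * p + [:0, 1:] * pderiv p) x * x powr c * exp (- x)"
  have "(LBINT x=ereal a..\<infinity>. ?f x) = 0 - ?F a"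
  proof (rule interval_integral_FTC_integrable)
    fix x assume "ereal a < ereal x"
    then have x: "x > 0" using assms by auto
    show "(?F has_vector_derivative ?f x) (at x)"
      using has_real_derivative_poly_powr_exp[OF x] by (simp add: has_real_derivative_iff_has_vector_derivative)
    show "isCont ?f x"
      using x by (intro continuous_intros) auto
  next
    show "set_integrable lborel (einterval (ereal a) \<infinity>) ?f"
    proof (rule set_integrable_subset)
      show "set_integrable lborel (if a = 0 then {0..} else {1..}) ?f"
        using assms set_integrable_poly_powr_exp[of c] set_integrable_poly_powr_exp_1[of _ c]
        by (auto simp del: poly_add poly_mult)
      show "einterval (ereal a) \<infinity> \<subseteq> (if a = 0 then {0..} else {1..})"
        using assms by (auto simp: einterval_def)
    qed simp
    have "continuous_on {a..} ?F"
      using assms by (intro continuous_on_mult continuous_on_powr' continuous_intros) auto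
    then have "(?F \<longlongrightarrow> ?F a) (at_right a)"
      unfolding continuous_on_def by (auto intro: tendsto_within_subset)
    then show "((?F \<circ> real_of_ereal) \<longlongrightarrow> ?F a) (at_right (ereal a))"
      by (simp add: ereal_tendsto_simps)
    show "((?F \<circ> real_of_ereal) \<longlongrightarrow> 0) (at_left \<infinity>)"
      using tendsto_poly_powr_exp by (simp add: ereal_tendsto_simps)
  qed simp
  also have "(LBINT x=ereal a..\<infinity>. ?f x) = (LINT x:{a<..}|lborel. ?f x)"
    by (simp add: interval_integral_to_infinity_eq)
  also have "\<dots> = (LINT x:{a..}|lborel. ?f x)"
  proof -
    have [measurable]: "?f \<in> borel_measurable borel"
      using borel_measurable_continuous_onI[OF continuous_on_poly[OF continuous_on_id]] by measurable
    show ?thesis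
      unfolding set_lebesgue_integral_def using AE_lborel_singleton[of a]
      by (intro integral_cong_AE) (measurable, auto simp: indicator_def elim!: eventually_mono)
  qed
  finally show ?thesis by simp
qed

section \<open>Orthogonality, step coefficients and the Christoffel--Darboux formula\<close>

text \<open>Closed form of the squared norm, identified as such in
  \<open>laguerre_orthogonal\<close>. Being explicit, it gives the recursion, the parameter shift
  and the growth rate directly from Gamma.\<close>

definition laguerre_norm2 :: "real \<Rightarrow> nat \<Rightarrow> real" where
  "laguerre_norm2 \<gamma> n = Gamma (real n + \<gamma> + 1) / fact n"

lemma laguerre_norm2_pos: "\<gamma> > -1 \<Longrightarrow> laguerre_norm2 \<gamma> n > 0"
  by (simp add: laguerre_norm2_def Gamma_real_pos)

lemma laguerre_norm2_Suc:
  assumes "\<gamma> > -1"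
  shows "laguerre_norm2 \<gamma> (Suc n) = laguerre_norm2 \<gamma> n * (real (Suc n) + \<gamma>) / real (Suc n)"
proof -
  have "Gamma (real n + \<gamma> + 1 + 1) = (real n + \<gamma> + 1) * Gamma (real n + \<gamma> + 1)"
    using assms by (intro Gamma_plus1) (auto dest: nonpos_Ints_nonpos)
  then show ?thesis
    by (simp add: laguerre_norm2_def add_ac mult_ac)
qed

lemma laguerre_norm2_shift: "real (Suc n) * laguerre_norm2 \<gamma> (Suc n) = laguerre_norm2 (\<gamma> + 1) n"
  by (simp add: laguerre_norm2_def add_ac del: of_nat_Suc) (simp add: add_ac)

lemma laguerre_inner_commute: "laguerre_inner \<gamma> f g = laguerre_inner \<gamma> g f"
  by (simp add: laguerre_inner_def mult.commute mult.left_commute)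

lemma set_integrable_laguerre_inner:
  fixes \<gamma> :: real
  assumes "\<gamma> > -1"
  shows "set_integrable lborel {0..} (\<lambda>x. poly p x * poly q x * x powr \<gamma> * exp (- x))"
  using set_integrable_poly_powr_exp[OF assms, of "p * q"] by simp

lemma laguerre_inner_sum_left:
  fixes \<gamma> :: real
  assumes "\<gamma> > -1"
  shows "laguerre_inner \<gamma> (\<lambda>x. \<Sum>i\<in>I. c i * poly (p i) x) (poly q) =
    (\<Sum>i\<in>I. c i * laguerre_inner \<gamma> (poly (p i)) (poly q))"
proof -
  have int: "integrable lborel (\<lambda>x. c i * (indicator {0..} x *\<^sub>R (poly (p i) x * poly q x * x powr \<gamma> * exp (- x))))" for i
    using set_integrable_laguerre_inner[OF assms] by (auto simp: set_integrable_def)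
  have "laguerre_inner \<gamma> (\<lambda>x. \<Sum>i\<in>I. c i * poly (p i) x) (poly q) =
    (LINT x|lborel. (\<Sum>i\<in>I. c i * (indicator {0..} x *\<^sub>R (poly (p i) x * poly q x * x powr \<gamma> * exp (- x)))))"
    by (simp add: laguerre_inner_def set_lebesgue_integral_def sum_distrib_right sum_distrib_left mult_ac)
  also have "\<dots> = (\<Sum>i\<in>I. LINT x|lborel. c i * (indicator {0..} x *\<^sub>R (poly (p i) x * poly q x * x powr \<gamma> * exp (- x))))"
    by (rule Bochner_Integration.integral_sum[OF int])
  finally show ?thesis
    by (simp add: laguerre_inner_def set_lebesgue_integral_def)
qed

text \<open>Laguerre's equation in Sturm-Liouville form: n x^\<gamma> e^(-x) L_n is the derivative
  of -x^(\<gamma> + 1) e^(-x) L_n'. Integrals of L_n against its weight thereby become boundary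
  terms.\<close>

lemma laguerre_operator:
  "poly ([:\<gamma> + 1, - 1:] * p + [:0, 1:] * pderiv p) x = real n * laguerre \<gamma> n x"
  if "p = - pderiv (laguerre_poly \<gamma> n)"
  using laguerre_ode[of x \<gamma> n] that by (simp add: pderiv_minus algebra_simps)

text \<open>Green's identity: differentiating -x^(\<gamma> + 1) e^(-x) L_n' L_m produces the
  difference of the two integrands, and the boundary term at 0 vanishes. Degrees drop by one while
  the parameter rises by one, which is the induction step for orthogonality.\<close>

lemma laguerre_inner_by_parts:
  assumes "\<gamma> > -1"
  shows "real n * laguerre_inner \<gamma> (laguerre \<gamma> n) (laguerre \<gamma> m) =
    laguerre_inner (\<gamma> + 1) (laguerre_deriv \<gamma> n) (laguerre_deriv \<gamma> m)"
proof -
  let ?P = "laguerre_poly \<gamma> n" and ?Q = "laguerre_poly \<gamma> m"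
  let ?p = "- pderiv ?P * ?Q"
  let ?f = "\<lambda>x. real n * (poly ?P x * poly ?Q x * x powr \<gamma> * exp (- x))"
  let ?g = "\<lambda>x. poly (pderiv ?P) x * poly (pderiv ?Q) x * x powr (\<gamma> + 1) * exp (- x)"
  have "(LINT x:{0..}|lborel. ?f x - ?g x) = (LINT x:{0..}|lborel.
      poly ([:\<gamma> + 1, - 1:] * ?p + [:0, 1:] * pderiv ?p) x * x powr \<gamma> * exp (- x))"
  proof (rule set_lebesgue_integral_cong)
    show "\<forall>x. x \<in> {0..} \<longrightarrow> ?f x - ?g x =
      poly ([:\<gamma> + 1, - 1:] * ?p + [:0, 1:] * pderiv ?p) x * x powr \<gamma> * exp (- x)"
    proof safe
      fix x :: real assume "x \<ge> 0"
      have eq: "poly ([:\<gamma> + 1, - 1:] * ?p + [:0, 1:] * pderiv ?p) x =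
          real n * poly ?P x * poly ?Q x - x * poly (pderiv ?P) x * poly (pderiv ?Q) x"
        using arg_cong[OF laguerre_operator[OF refl, of \<gamma> n x], of "\<lambda>t. t * poly ?Q x"]
        by (simp add: laguerre_eq_poly pderiv_mult pderiv_minus algebra_simps)
      have powr: "x powr (\<gamma> + 1) = x * x powr \<gamma>"
        using power_mult_powr[OF \<open>x \<ge> 0\<close>, of 1 \<gamma>] by simp
      show "?f x - ?g x =
        poly ([:\<gamma> + 1, - 1:] * ?p + [:0, 1:] * pderiv ?p) x * x powr \<gamma> * exp (- x)"
        unfolding eq powr by (simp add: algebra_simps)
    qed
  qed simp
  also have "\<dots> = 0"
    using LINT_poly_powr_exp_derivative[of 0 \<gamma> ?p] assms by simp
  finally have "(LINT x:{0..}|lborel. ?f x - ?g x) = 0" .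
  moreover have "set_integrable lborel {0..} ?f" "set_integrable lborel {0..} ?g"
    using set_integrable_laguerre_inner assms by auto
  ultimately show ?thesis
    by (simp add: set_integral_diff laguerre_inner_def laguerre_eq_poly[abs_def])
qed

lemma laguerre_orthogonal:
  assumes "\<gamma> > -1"
  shows "laguerre_inner \<gamma> (laguerre \<gamma> n) (laguerre \<gamma> m) = (if n = m then laguerre_norm2 \<gamma> n else 0)"
  using assms
proof (induction n arbitrary: \<gamma> m)
  case 0
  show ?case
  proof (cases m)
    case 0
    have "has_bochner_integral lborel (\<lambda>x. indicator {0..} x *\<^sub>R (x powr \<gamma> * exp (- x))) (Gamma (\<gamma> + 1))"
      using has_bochner_integral_Gamma[of "\<gamma> + 1"] \<open>\<gamma> > -1\<close> by simp
    then show ?thesis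
      using 0 by (simp add: laguerre_inner_def laguerre_norm2_def set_lebesgue_integral_def
          has_bochner_integral_integral_eq)
  next
    case (Suc k)
    \<comment> \<open>For n = 0 the factor \<open>real n\<close> carries no information, so the
      identity is applied with the two polynomials exchanged, which brings in the positive factor
      m.\<close>
    have "real m * laguerre_inner \<gamma> (laguerre \<gamma> m) (laguerre \<gamma> 0) = 0"
      using \<open>\<gamma> > -1\<close> by (subst laguerre_inner_by_parts) (simp_all add: laguerre_inner_def)
    then have "laguerre_inner \<gamma> (laguerre \<gamma> 0) (laguerre \<gamma> m) = 0"
      unfolding laguerre_inner_commute[of \<gamma> "laguerre \<gamma> 0"] using Suc by (simp del: of_nat_Suc)
    then show ?thesis using Suc by (simp only:) simp
  qed
next
  case (Suc n)
  have "real (Suc n) * laguerre_inner \<gamma> (laguerre \<gamma> (Suc n)) (laguerre \<gamma> m) =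
      real (Suc n) * (if Suc n = m then laguerre_norm2 \<gamma> (Suc n) else 0)"
  proof (cases m)
    case 0
    then show ?thesis
      using Suc.prems by (subst laguerre_inner_by_parts) (simp_all add: laguerre_inner_def)
  next
    case (Suc k)
    have "real (Suc n) * laguerre_inner \<gamma> (laguerre \<gamma> (Suc n)) (laguerre \<gamma> m) =
        laguerre_inner (\<gamma> + 1) (laguerre (\<gamma> + 1) n) (laguerre (\<gamma> + 1) k)"
      using Suc Suc.prems
      by (subst laguerre_inner_by_parts) (simp_all add: laguerre_inner_def laguerre_deriv_Suc)
    also have "\<dots> = (if n = k then laguerre_norm2 (\<gamma> + 1) n else 0)"
      using Suc.prems by (intro Suc.IH) simp
    finally show ?thesis
      using Suc laguerre_norm2_shift[of n \<gamma>] by auto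
  qed
  then show ?case by (simp del: of_nat_Suc)
qed

text \<open>The weighted L_j has the antiderivative of \<open>laguerre_operator\<close>, so cutting
  the integral at 1 leaves one boundary term. The factor j stays on the left: the case j = 0 is then
  trivial, and that coefficient disappears when the expansion is differentiated.\<close>

lemma laguerre_coeff_step:
  assumes "\<alpha> > -1"
  shows "real j * laguerre_norm2 \<alpha> j * laguerre_coeff \<alpha> step j = exp (- 1) * laguerre_deriv \<alpha> j 1"
proof -
  let ?p = "- pderiv (laguerre_poly \<alpha> j)"
  have "real j * laguerre_inner \<alpha> step (laguerre \<alpha> j) =
      (LINT x:{0..}|lborel. step x * real j * laguerre \<alpha> j x * x powr \<alpha> * exp (- x))"
    unfolding laguerre_inner_def by (subst set_integral_mult_right[symmetric]) (simp add: mult_ac)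
  also have "\<dots> = (LINT x:{1..}|lborel. real j * laguerre \<alpha> j x * x powr \<alpha> * exp (- x))"
    unfolding set_lebesgue_integral_def
    by (intro Bochner_Integration.integral_cong) (auto simp: step_def indicator_def)
  also have "\<dots> = (LINT x:{1..}|lborel.
      poly ([:\<alpha> + 1, - 1:] * ?p + [:0, 1:] * pderiv ?p) x * x powr \<alpha> * exp (- x))"
    by (simp only: laguerre_operator[OF refl])
  also have "\<dots> = exp (- 1) * laguerre_deriv \<alpha> j 1"
    using LINT_poly_powr_exp_derivative[of 1 \<alpha> ?p] by (simp add: mult.commute)
  finally show ?thesis
    using laguerre_norm2_pos[OF assms, of j] laguerre_orthogonal[OF assms, of j j]
    by (simp add: laguerre_coeff_def)
qed

text \<open>Two minus signs cancel, one from the derivative at 1 inside the coefficient and one from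
  the derivative at x. By \<open>laguerre_norm2_shift\<close> the denominators become the squared
  norms for \<alpha> + 1, so the sum is the reproducing kernel of that family.\<close>

lemma laguerre_expansion_step_has_real_derivative:
  assumes "\<alpha> > -1"
  shows "(laguerre_expansion \<alpha> n step has_real_derivative
    exp (- 1) * (\<Sum>k<n. laguerre (\<alpha> + 1) k x * laguerre (\<alpha> + 1) k 1 / laguerre_norm2 (\<alpha> + 1) k)) (at x)"
proof -
  have "(laguerre_expansion \<alpha> n step has_real_derivative
      (\<Sum>j=0..n. laguerre_coeff \<alpha> step j * laguerre_deriv \<alpha> j x)) (at x)"
    unfolding laguerre_expansion_def[abs_def]
    by (intro DERIV_sum DERIV_cmult laguerre_has_real_derivative)
  also have "(\<Sum>j=0..n. laguerre_coeff \<alpha> step j * laguerre_deriv \<alpha> j x) =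
      (\<Sum>k<n. laguerre_coeff \<alpha> step (Suc k) * laguerre_deriv \<alpha> (Suc k) x)"
    unfolding atLeast0AtMost lessThan_Suc_atMost[symmetric] sum.lessThan_Suc_shift by simp
  also have "\<dots> = (\<Sum>k<n. exp (- 1) * (laguerre (\<alpha> + 1) k x * laguerre (\<alpha> + 1) k 1 / laguerre_norm2 (\<alpha> + 1) k))"
  proof (rule sum.cong[OF refl])
    fix k
    have "laguerre_norm2 (\<alpha> + 1) k * laguerre_coeff \<alpha> step (Suc k) = - exp (- 1) * laguerre (\<alpha> + 1) k 1"
      using laguerre_coeff_step[OF assms, of "Suc k"] unfolding laguerre_norm2_shift laguerre_deriv_Suc by simp
    then have "laguerre_coeff \<alpha> step (Suc k) = - exp (- 1) * laguerre (\<alpha> + 1) k 1 / laguerre_norm2 (\<alpha> + 1) k"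
      using laguerre_norm2_pos[of "\<alpha> + 1" k] assms by (simp add: field_simps)
    then show "laguerre_coeff \<alpha> step (Suc k) * laguerre_deriv \<alpha> (Suc k) x =
        exp (- 1) * (laguerre (\<alpha> + 1) k x * laguerre (\<alpha> + 1) k 1 / laguerre_norm2 (\<alpha> + 1) k)"
      unfolding laguerre_deriv_Suc by simp
  qed
  finally show ?thesis by (simp add: sum_distrib_left)
qed

text \<open>The numerator uses derivatives at degree n in place of a neighbouring degree: this makes
  it Wronskian-like, so that the differential equation can be brought to bear, and both sides are 0
  for n = 0.\<close>

lemma laguerre_Christoffel_Darboux:
  assumes "\<gamma> > -1"
  shows "(x - y) * (\<Sum>k<n. laguerre \<gamma> k x * laguerre \<gamma> k y / laguerre_norm2 \<gamma> k) =
    (laguerre \<gamma> n x * (y * laguerre_deriv \<gamma> n y) - x * laguerre_deriv \<gamma> n x * laguerre \<gamma> n y)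
      / laguerre_norm2 \<gamma> n"
proof (induction n)
  case 0
  then show ?case by simp
next
  case (Suc n)
  define h where "h = laguerre_norm2 \<gamma> n"
  define u where "u = laguerre \<gamma> n x"
  define v where "v = laguerre \<gamma> n y"
  define u' where "u' = x * laguerre_deriv \<gamma> n x"
  define v' where "v' = y * laguerre_deriv \<gamma> n y"
  define U where "U = laguerre \<gamma> (Suc n) x"
  define V where "V = laguerre \<gamma> (Suc n) y"
  define N where "N = real (Suc n)"
  have pos: "h > 0" "N > 0" "N + \<gamma> > 0"
    using laguerre_norm2_pos[OF assms] assms by (auto simp: h_def N_def)
  have U: "N * U = u' + (N + \<gamma> - x) * u" and V: "N * V = v' + (N + \<gamma> - y) * v"
    unfolding N_def U_def V_def u_def v_def u'_def v'_def by (rule laguerre_Suc)+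
  \<comment> \<open>Rewriting the derivatives at degree n + 1 produces \<open>N * U * V\<close>
    twice with opposite signs; what remains is the classical numerator in degrees n and n +
    1.\<close>
  have "(U * (y * laguerre_deriv \<gamma> (Suc n) y) - x * laguerre_deriv \<gamma> (Suc n) x * V) / laguerre_norm2 \<gamma> (Suc n)
      = (U * (N * V - (N + \<gamma>) * v) - (N * U - (N + \<gamma>) * u) * V) / (h * (N + \<gamma>) / N)"
    unfolding x_laguerre_deriv_Suc laguerre_norm2_Suc[OF assms] U_def V_def u_def v_def N_def h_def ..
  also have "\<dots> = ((N + \<gamma>) * (u * (N * V) - N * U * v)) / ((N + \<gamma>) * h)"
    using pos by (simp add: divide_simps) (simp add: algebra_simps)
  also have "\<dots> = (u * (N * V) - N * U * v) / h"
    using pos by simp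
  also have "\<dots> = (u * v' - u' * v) / h + (x - y) * (u * v / h)"
    unfolding U V using pos by (simp add: field_simps)
  also have "(u * v' - u' * v) / h = (x - y) * (\<Sum>k<n. laguerre \<gamma> k x * laguerre \<gamma> k y / laguerre_norm2 \<gamma> k)"
    unfolding Suc.IH u_def v_def u'_def v'_def h_def ..
  finally show ?case
    by (simp add: U_def V_def u_def v_def h_def distrib_left)
qed

section \<open>The weighted square integral with shifted exponent\<close>

text \<open>The factors (-1)^m (\<delta> choose m) are the coefficients of (1 - t)^\<delta>, by
  which the generating functions of the two families differ. On coefficients this is Vandermonde's
  convolution, applied after negating the upper entries.\<close>

lemma laguerre_poly_connection:
  "laguerre_poly \<gamma> n = (\<Sum>m\<le>n. smult ((- 1) ^ m * (\<delta> gchoose m)) (laguerre_poly (\<gamma> + \<delta>) (n - m)))"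
proof (rule poly_eqI)
  fix j
  show "coeff (laguerre_poly \<gamma> n) j =
    coeff (\<Sum>m\<le>n. smult ((- 1) ^ m * (\<delta> gchoose m)) (laguerre_poly (\<gamma> + \<delta>) (n - m))) j"
  proof (cases "j \<le> n")
    case False
    then show ?thesis by (auto simp: coeff_laguerre_poly coeff_sum intro!: sum.neutral)
  next
    case True
    define N where "N = n - j"
    have n: "n = N + j" using True by (simp add: N_def)
    have "((real n + \<gamma>) gchoose N) = (- 1) ^ N * ((\<delta> + (- \<gamma> - \<delta> - real j - 1)) gchoose N)"
    proof -
      have "real N - (real n + \<gamma>) - 1 = \<delta> + (- \<gamma> - \<delta> - real j - 1)" by (simp add: n)
      then show ?thesis unfolding gbinomial_negated_upper[of "real n + \<gamma>"] by (simp only:)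
    qed
    also have "\<dots> = (\<Sum>m=0..N. (- 1) ^ m * (\<delta> gchoose m) *
        ((- 1) ^ (N - m) * ((- \<gamma> - \<delta> - real j - 1) gchoose (N - m))))"
      unfolding gbinomial_Vandermonde[symmetric] sum_distrib_left
    proof (rule sum.cong[OF refl])
      fix m assume "m \<in> {0..N}"
      then have sign: "(- 1 :: real) ^ N = (- 1) ^ m * (- 1) ^ (N - m)"
        by (simp flip: power_add)
      show "(- 1) ^ N * ((\<delta> gchoose m) * ((- \<gamma> - \<delta> - real j - 1) gchoose (N - m))) =
          (- 1) ^ m * (\<delta> gchoose m) * ((- 1) ^ (N - m) * ((- \<gamma> - \<delta> - real j - 1) gchoose (N - m)))"
        unfolding sign by (simp only: mult_ac)
    qed
    also have "\<dots> = (\<Sum>m=0..N. (- 1) ^ m * (\<delta> gchoose m) * ((real (n - m) + (\<gamma> + \<delta>)) gchoose (N - m)))"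
    proof (rule sum.cong[OF refl])
      fix m assume "m \<in> {0..N}"
      then have eq: "real (N - m) - (real (n - m) + (\<gamma> + \<delta>)) - 1 = - \<gamma> - \<delta> - real j - 1"
        by (simp add: n of_nat_diff)
      show "(- 1) ^ m * (\<delta> gchoose m) * ((- 1) ^ (N - m) * ((- \<gamma> - \<delta> - real j - 1) gchoose (N - m)))
          = (- 1) ^ m * (\<delta> gchoose m) * ((real (n - m) + (\<gamma> + \<delta>)) gchoose (N - m))"
        unfolding gbinomial_negated_upper[of "real (n - m) + (\<gamma> + \<delta>)"] eq ..
    qed
    finally have "((real n + \<gamma>) gchoose N) * (- 1) ^ j / fact j =
      (\<Sum>m=0..N. (- 1) ^ m * (\<delta> gchoose m) * (((real (n - m) + (\<gamma> + \<delta>)) gchoose (N - m)) * (- 1) ^ j / fact j))"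
      by (simp add: sum_distrib_right sum_divide_distrib mult.assoc)
    also have "\<dots> = (\<Sum>m=0..N. (- 1) ^ m * (\<delta> gchoose m) * coeff (laguerre_poly (\<gamma> + \<delta>) (n - m)) j)"
    proof (rule sum.cong[OF refl])
      fix m assume "m \<in> {0..N}"
      then have "j \<le> n - m" "n - m - j = N - m" by (auto simp: n)
      then show "(- 1) ^ m * (\<delta> gchoose m) * (((real (n - m) + (\<gamma> + \<delta>)) gchoose (N - m)) * (- 1) ^ j / fact j)
        = (- 1) ^ m * (\<delta> gchoose m) * coeff (laguerre_poly (\<gamma> + \<delta>) (n - m)) j"
        by (simp add: coeff_laguerre_poly)
    qed
    also have "\<dots> = (\<Sum>m\<le>n. (- 1) ^ m * (\<delta> gchoose m) * coeff (laguerre_poly (\<gamma> + \<delta>) (n - m)) j)"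
      by (rule sum.mono_neutral_left) (auto simp: n coeff_laguerre_poly)
    finally show ?thesis
      using True by (simp add: coeff_laguerre_poly coeff_sum N_def)
  qed
qed

text \<open>For the raised weight the family with parameter \<gamma> + 1/2 is the orthogonal one.
  After the change of family the integral is Parseval's sum, and the signs (-1)^m square
  away.\<close>

lemma laguerre_inner_half_shift:
  assumes "\<gamma> > - 1"
  shows "laguerre_inner (\<gamma> + 1 / 2) (laguerre \<gamma> n) (laguerre \<gamma> n) =
    (\<Sum>m\<le>n. (1 / 2 gchoose m)\<^sup>2 * laguerre_norm2 (\<gamma> + 1 / 2) (n - m))"
proof -
  let ?\<delta> = "\<gamma> + 1 / 2"
  define a :: "nat \<Rightarrow> real" where "a = (\<lambda>m. (- 1) ^ m * (1 / 2 gchoose m))"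
  define p where "p = (\<lambda>m. laguerre_poly ?\<delta> (n - m))"
  have \<delta>: "?\<delta> > - 1" using assms by simp
  have L: "laguerre \<gamma> n = (\<lambda>x. \<Sum>m\<le>n. a m * poly (p m) x)"
    unfolding laguerre_eq_poly[abs_def] laguerre_poly_connection[of \<gamma> n "1 / 2"] a_def p_def
    by (rule ext) (simp add: poly_sum)
  have orth: "laguerre_inner ?\<delta> (poly (p m)) (poly (p k)) = (if k = m then laguerre_norm2 ?\<delta> (n - m) else 0)"
    if "m \<le> n" "k \<le> n" for m k
    using laguerre_orthogonal[OF \<delta>, of "n - m" "n - k"] that
    by (auto simp: p_def laguerre_eq_poly[abs_def])
  have 1: "laguerre_inner ?\<delta> (laguerre \<gamma> n) (poly (p k)) = a k * laguerre_norm2 ?\<delta> (n - k)" if "k \<le> n" for k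
  proof -
    have "laguerre_inner ?\<delta> (laguerre \<gamma> n) (poly (p k)) =
        (\<Sum>m\<le>n. a m * laguerre_inner ?\<delta> (poly (p m)) (poly (p k)))"
      unfolding L by (rule laguerre_inner_sum_left[OF \<delta>])
    also have "\<dots> = (\<Sum>m\<le>n. if k = m then a m * laguerre_norm2 ?\<delta> (n - m) else 0)"
      using that orth by (intro sum.cong) auto
    finally show ?thesis using that by simp
  qed
  have "laguerre_inner ?\<delta> (laguerre \<gamma> n) (laguerre \<gamma> n) =
      (\<Sum>m\<le>n. a m * laguerre_inner ?\<delta> (poly (p m)) (poly (laguerre_poly \<gamma> n)))"
    by (subst (1) L, subst laguerre_inner_sum_left[OF \<delta>, symmetric]) (simp add: laguerre_eq_poly[abs_def])
  also have "\<dots> = (\<Sum>m\<le>n. a m * (a m * laguerre_norm2 ?\<delta> (n - m)))"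
    using 1 by (intro sum.cong) (auto simp: laguerre_inner_commute[of _ "poly (p _)"] laguerre_eq_poly[abs_def])
  finally show ?thesis
    by (auto simp: a_def power2_eq_square minus_one_power_iff intro!: sum.cong)
qed

section \<open>Growth of the squared norms and the constant 4/pi\<close>

lemma laguerre_norm2_asymp:
  assumes "\<gamma> > -1"
  shows "(\<lambda>n. laguerre_norm2 \<gamma> n / real n powr \<gamma>) \<longlonglongrightarrow> 1"
proof -
  let ?z = "\<gamma> + 1"
  have z: "?z > 0" "?z \<notin> \<int>\<^sub>\<le>\<^sub>0" and G: "Gamma ?z > 0"
    using assms by (auto dest: nonpos_Ints_nonpos intro: Gamma_real_pos)
  \<comment> \<open>\<open>Gamma_series\<close> is Euler's limit for Gamma. Its denominator has the
    factors z, ..., z + n, one more than Gamma (n + z) supplies, and its numerator has n^(\<gamma> +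
    1) instead of n^\<gamma>; the quotient n / (n + z) corrects both.\<close>
  have "(\<lambda>n. Gamma ?z / Gamma_series ?z n * (real n / (real n + ?z))) \<longlonglongrightarrow> Gamma ?z / Gamma ?z * 1"
    using G by (intro tendsto_intros) (auto, real_asymp)
  moreover have "\<forall>\<^sub>F n in sequentially. Gamma ?z / Gamma_series ?z n * (real n / (real n + ?z)) =
      laguerre_norm2 \<gamma> n / real n powr \<gamma>"
    using eventually_gt_at_top[of 0]
  proof eventually_elim
    case (elim n)
    have p: "pochhammer ?z n = Gamma (real n + ?z) / Gamma ?z" "Gamma (real n + ?z) > 0"
      using pochhammer_Gamma[OF z(2), of n] z(1) by (auto simp: add_ac intro: Gamma_real_pos)
    have "exp (?z * ln (real n)) = real n * real n powr \<gamma>"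
      using elim by (simp add: powr_def distrib_right exp_add)
    then have 1: "Gamma_series ?z n = fact n * (real n * real n powr \<gamma>) /
        (Gamma (real n + ?z) / Gamma ?z * (real n + ?z))"
      using p by (simp add: Gamma_series_def pochhammer_Suc add_ac)
    have 2: "laguerre_norm2 \<gamma> n = Gamma (real n + ?z) / fact n"
      by (simp add: laguerre_norm2_def add_ac)
    have "real n + ?z > 0" "real n powr \<gamma> > 0" "real n > 0" "(fact n :: real) > 0"
      using elim z(1) by auto
    then show ?case
      unfolding 1 2 using p(2) G by (simp add: divide_simps)
  qed
  ultimately show ?thesis using G Lim_transform_eventually by fastforce
qed

text \<open>For \<open>\<gamma> = - 1 / 2\<close> the term \<open>\<kappa> / t\<^sup>2\<close> vanishes and the energy identity for the oscillator,
  taken at \<open>t = 0\<close>, is exact; this is where the closed form comes from.\<close>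

lemma sum_gbinomial_half_square:
  "(\<Sum>m\<le>n. (1 / 2 gchoose m)\<^sup>2 :: real) = (4 * real n + 1) * (laguerre_norm2 (- 1 / 2) n)\<^sup>2 / pi"
proof -
  \<comment> \<open>\<open>laguerre_norm2 (- 1 / 2) n\<close> is Gamma (n + 1/2) / n!, and the
    absolute value of (-1/2 choose n) is this number divided by sqrt pi.\<close>
  have neg_half: "((- 1 / 2 :: real) gchoose n)\<^sup>2 = (laguerre_norm2 (- 1 / 2) n)\<^sup>2 / pi" for n
  proof (induction n)
    case 0
    then show ?case by (simp add: laguerre_norm2_def Gamma_one_half_real)
  next
    case (Suc n)
    have "real (Suc n) * ((- 1 / 2) gchoose Suc n) = - (real n + 1 / 2) * ((- 1 / 2) gchoose n)"
      using gbinomial_mult_1[of "- 1 / 2 :: real" n] by (simp add: algebra_simps)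
    then have "((- 1 / 2) gchoose Suc n) = - (real n + 1 / 2) * ((- 1 / 2) gchoose n) / real (Suc n)"
      by (simp add: field_simps)
    moreover have "(- real n - 1 / 2)\<^sup>2 = (real n + 1 / 2)\<^sup>2"
      by (simp add: power2_eq_square algebra_simps)
    ultimately show ?case
      using Suc.IH laguerre_norm2_Suc[of "- 1 / 2" n]
      by (simp add: power_mult_distrib power_divide add_ac mult_ac)
  qed
  show ?thesis
  proof (induction n)
    case 0
    then show ?case using neg_half[of 0] by simp
  next
    case (Suc n)
    define b where "b = (laguerre_norm2 (- 1 / 2) n)\<^sup>2 / pi"
    have "((1 / 2) gchoose Suc n) = (1 / 2) / real (Suc n) * ((- 1 / 2 :: real) gchoose n)"
      using gbinomial_absorption'[of "Suc n" "1 / 2 :: real"] by simp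
    then have 1: "((1 / 2) gchoose Suc n)\<^sup>2 = (1 / 4) / (real (Suc n))\<^sup>2 * b"
      using neg_half[of n] by (simp add: b_def power_mult_distrib power_divide del: of_nat_Suc)
    have 2: "(laguerre_norm2 (- 1 / 2) (Suc n))\<^sup>2 / pi = b * (real n + 1 / 2)\<^sup>2 / (real (Suc n))\<^sup>2"
      using laguerre_norm2_Suc[of "- 1 / 2" n]
      by (simp add: b_def power_mult_distrib power_divide add_ac mult_ac)
    have "(\<Sum>m\<le>Suc n. (1 / 2 gchoose m)\<^sup>2) = (4 * real n + 1) * b + (1 / 4) / (real (Suc n))\<^sup>2 * b"
      using Suc 1 by (simp add: b_def)
    also have "\<dots> = ((4 * real n + 1) * (real (Suc n))\<^sup>2 + 1 / 4) * b / (real (Suc n))\<^sup>2"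
      by (simp add: add_divide_distrib distrib_right del: of_nat_Suc)
    also have "(4 * real n + 1) * (real (Suc n))\<^sup>2 + 1 / 4 = (4 * real (Suc n) + 1) * (real n + 1 / 2)\<^sup>2"
      by (simp add: power2_eq_square algebra_simps)
    finally show ?case
      unfolding times_divide_eq_right[symmetric, of "4 * real (Suc n) + 1"] 2 by (simp add: mult_ac)
  qed
qed

text \<open>In the closed form of the partial sums the squared factor behaves like 1 / n, which
  against 4 n + 1 leaves 4 / pi.\<close>

lemma gbinomial_half_square_sums: "(\<lambda>m. (1 / 2 gchoose m)\<^sup>2 :: real) sums (4 / pi)"
proof -
  have "(\<lambda>n. (4 * real n + 1) / real n * (laguerre_norm2 (- 1 / 2) n / real n powr (- 1 / 2))\<^sup>2 / pi)
      \<longlonglongrightarrow> 4 * 1\<^sup>2 / pi"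
    by (intro tendsto_intros laguerre_norm2_asymp) (simp_all, real_asymp)
  moreover have "\<forall>\<^sub>F n in sequentially. (4 * real n + 1) / real n *
      (laguerre_norm2 (- 1 / 2) n / real n powr (- 1 / 2))\<^sup>2 / pi = (\<Sum>m\<le>n. (1 / 2 gchoose m)\<^sup>2)"
    using eventually_gt_at_top[of 0]
  proof eventually_elim
    case (elim n)
    then have "(real n powr (- 1 / 2))\<^sup>2 = 1 / real n"
      by (simp add: powr_minus_divide powr_half_sqrt power_divide)
    then show ?case
      using elim unfolding sum_gbinomial_half_square by (simp add: power_divide field_simps)
  qed
  ultimately have "(\<lambda>n. \<Sum>m\<le>n. (1 / 2 gchoose m)\<^sup>2 :: real) \<longlonglongrightarrow> 4 / pi"
    using Lim_transform_eventually by fastforce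
  then show ?thesis by (simp add: sums_def_le)
qed

text \<open>The ratio of consecutive values is (n + 1 + \<gamma>) / (n + 1), at least 1 for \<gamma>
  \<ge> 0. This supplies the domination in Tannery's theorem.\<close>

lemma laguerre_norm2_mono:
  assumes "\<gamma> \<ge> 0" "m \<le> n"
  shows "laguerre_norm2 \<gamma> m \<le> laguerre_norm2 \<gamma> n"
proof (rule lift_Suc_mono_le[of "laguerre_norm2 \<gamma>", OF _ \<open>m \<le> n\<close>])
  fix n
  have "laguerre_norm2 \<gamma> n * 1 \<le> laguerre_norm2 \<gamma> n * ((real (Suc n) + \<gamma>) / real (Suc n))"
    using assms laguerre_norm2_pos[of \<gamma> n] by (intro mult_left_mono) auto
  then show "laguerre_norm2 \<gamma> n \<le> laguerre_norm2 \<gamma> (Suc n)"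
    using assms by (simp add: laguerre_norm2_Suc)
qed

lemma laguerre_norm2_ratio_tendsto:
  assumes "\<gamma> > -1"
  shows "(\<lambda>n. laguerre_norm2 \<gamma> (n - m) / laguerre_norm2 \<gamma> n) \<longlonglongrightarrow> 1"
proof -
  have "(\<lambda>n. laguerre_norm2 \<gamma> n / laguerre_norm2 \<gamma> (n + m)) \<longlonglongrightarrow> 1"
  proof -
    have "(\<lambda>n. (laguerre_norm2 \<gamma> n / real n powr \<gamma>) / (laguerre_norm2 \<gamma> (n + m) / real (n + m) powr \<gamma>)
        * (real n / real (n + m)) powr \<gamma>) \<longlonglongrightarrow> 1 / 1 * 1 powr \<gamma>"
    proof (rule tendsto_mult[OF tendsto_divide tendsto_powr])
      show "(\<lambda>n. laguerre_norm2 \<gamma> n / real n powr \<gamma>) \<longlonglongrightarrow> 1"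
        by (rule laguerre_norm2_asymp[OF assms])
      show "(\<lambda>n. laguerre_norm2 \<gamma> (n + m) / real (n + m) powr \<gamma>) \<longlonglongrightarrow> 1"
        by (rule LIMSEQ_ignore_initial_segment[OF laguerre_norm2_asymp[OF assms]])
      show "(\<lambda>n. real n / real (n + m)) \<longlonglongrightarrow> 1" by real_asymp
    qed simp_all
    moreover have "\<forall>\<^sub>F n in sequentially. (laguerre_norm2 \<gamma> n / real n powr \<gamma>) / (laguerre_norm2 \<gamma> (n + m) / real (n + m) powr \<gamma>)
        * (real n / real (n + m)) powr \<gamma> = laguerre_norm2 \<gamma> n / laguerre_norm2 \<gamma> (n + m)"
      using eventually_gt_at_top[of 0] by eventually_elim (simp add: powr_divide)
    ultimately show ?thesis using Lim_transform_eventually by fastforce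
  qed
  then show ?thesis
    by (intro LIMSEQ_offset[where k = m and f = "\<lambda>n. laguerre_norm2 \<gamma> (n - m) / laguerre_norm2 \<gamma> n"]) simp
qed

text \<open>Divided by the norm for \<gamma> + 1/2 at n, each term of the sum tends to (1/2 choose
  m)^2 and is dominated by it, so Tannery's theorem applies; \<gamma> > -1/2 makes these norms
  increase with the degree. The factor sqrt n is the ratio of the growth rates of the two
  norms.\<close>

lemma laguerre_inner_half_shift_asymp:
  assumes "\<gamma> > - 1 / 2"
  shows "(\<lambda>n. laguerre_inner (\<gamma> + 1 / 2) (laguerre \<gamma> n) (laguerre \<gamma> n) / (laguerre_norm2 \<gamma> n * sqrt (real n)))
    \<longlonglongrightarrow> 4 / pi"
proof -
  let ?\<delta> = "\<gamma> + 1 / 2"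
  define r where "r = (\<lambda>m n. laguerre_norm2 ?\<delta> (n - m) / laguerre_norm2 ?\<delta> n)"
  define f :: "nat \<Rightarrow> nat \<Rightarrow> real" where
    "f = (\<lambda>m n. if m \<le> n then (1 / 2 gchoose m)\<^sup>2 * r m n else 0)"
  have \<delta>: "?\<delta> > -1" "?\<delta> \<ge> 0" using assms by auto
  have pos: "laguerre_norm2 ?\<delta> n > 0" "laguerre_norm2 \<gamma> n > 0" for n
    using \<delta> assms by (auto intro!: laguerre_norm2_pos)
  have r: "0 \<le> r m n" "r m n \<le> 1" for m n
    using pos(1)[of n] pos(1)[of "n - m"] laguerre_norm2_mono[OF \<delta>(2), of "n - m" n] by (auto simp: r_def)
  have "(\<lambda>n. \<Sum>m. f m n) \<longlonglongrightarrow> (\<Sum>m. (1 / 2 gchoose m)\<^sup>2)"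
  proof (rule tannerys_theorem[THEN conjunct2, THEN conjunct2])
    show "(f m \<longlongrightarrow> (1 / 2 gchoose m)\<^sup>2) sequentially" for m
    proof -
      have "(\<lambda>n. (1 / 2 gchoose m)\<^sup>2 * r m n) \<longlonglongrightarrow> (1 / 2 gchoose m)\<^sup>2 * 1"
        unfolding r_def by (intro tendsto_intros laguerre_norm2_ratio_tendsto \<delta>)
      moreover have "\<forall>\<^sub>F n in sequentially. (1 / 2 gchoose m)\<^sup>2 * r m n = f m n"
        using eventually_ge_at_top[of m] by eventually_elim (simp add: f_def)
      ultimately show ?thesis using Lim_transform_eventually by fastforce
    qed
    show "\<forall>\<^sub>F (m, n) in at_top \<times>\<^sub>F sequentially. norm (f m n) \<le> (1 / 2 gchoose m)\<^sup>2"
      using r by (intro always_eventually) (auto simp: f_def abs_mult mult_left_le)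
    show "summable (\<lambda>m. (1 / 2 gchoose m)\<^sup>2 :: real)"
      using gbinomial_half_square_sums by (rule sums_summable)
  qed simp
  moreover have "(\<Sum>m. f m n) = (\<Sum>m\<le>n. (1 / 2 gchoose m)\<^sup>2 * r m n)" for n
    by (subst suminf_finite[of "{..n}"]) (auto simp: f_def)
  moreover have "(\<Sum>m. (1 / 2 gchoose m)\<^sup>2 :: real) = 4 / pi"
    using gbinomial_half_square_sums by (rule sums_unique[symmetric])
  ultimately have 1: "(\<lambda>n. \<Sum>m\<le>n. (1 / 2 gchoose m)\<^sup>2 * r m n) \<longlonglongrightarrow> 4 / pi"
    by simp
  have "(\<lambda>n. (laguerre_norm2 ?\<delta> n / real n powr ?\<delta>) / (laguerre_norm2 \<gamma> n / real n powr \<gamma>)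
      * (\<Sum>m\<le>n. (1 / 2 gchoose m)\<^sup>2 * r m n)) \<longlonglongrightarrow> 1 / 1 * (4 / pi)"
    using assms \<delta> by (intro tendsto_mult[OF tendsto_divide] 1 laguerre_norm2_asymp) simp_all
  moreover have "\<forall>\<^sub>F n in sequentially. (laguerre_norm2 ?\<delta> n / real n powr ?\<delta>) / (laguerre_norm2 \<gamma> n / real n powr \<gamma>)
      * (\<Sum>m\<le>n. (1 / 2 gchoose m)\<^sup>2 * r m n) =
      laguerre_inner ?\<delta> (laguerre \<gamma> n) (laguerre \<gamma> n) / (laguerre_norm2 \<gamma> n * sqrt (real n))"
    using eventually_gt_at_top[of 0]
  proof eventually_elim
    case (elim n)
    have "(\<Sum>m\<le>n. (1 / 2 gchoose m)\<^sup>2 * r m n) =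
        laguerre_inner ?\<delta> (laguerre \<gamma> n) (laguerre \<gamma> n) / laguerre_norm2 ?\<delta> n"
      using assms by (subst laguerre_inner_half_shift) (auto simp: r_def sum_divide_distrib)
    moreover have "real n powr ?\<delta> = real n powr \<gamma> * sqrt (real n)"
      by (simp add: powr_add powr_half_sqrt)
    moreover have cancel: "(A / (P * s)) / (B / P) * (J / A) = J / (B * s)"
      if "A > 0" "B > 0" "P > 0" for A B P s J :: real
      using that by simp
    ultimately show ?case
      using cancel[OF pos(1)[of n] pos(2)[of n], of "real n powr \<gamma>"] elim by simp
  qed
  ultimately show ?thesis using Lim_transform_eventually by fastforce
qed

section \<open>The associated oscillator and its energy\<close>

text \<open>Variation of constants: rotating (v, v') back by the angle s gives \<open>a\<close> and
  \<open>b\<close>, which are constant when \<delta> = 0 and otherwise drift by \<epsilon> times the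
  size of v. The range reaches to 4 so that pi is interior, and the error carries a factor s because
  it is divided by s later.\<close>

lemma oscillator_perturbation_right:
  fixes v v' \<delta> :: "real \<Rightarrow> real" and \<epsilon> :: real
  assumes s: "0 \<le> s" "s \<le> 4" and eps: "\<epsilon> \<le> 1 / 4"
    and v: "\<And>x. 0 \<le> x \<Longrightarrow> x \<le> 4 \<Longrightarrow> (v has_real_derivative v' x) (at x)"
    and v': "\<And>x. 0 \<le> x \<Longrightarrow> x \<le> 4 \<Longrightarrow> (v' has_real_derivative - (1 - \<delta> x) * v x) (at x)"
    and \<delta>: "\<And>x. 0 \<le> x \<Longrightarrow> x \<le> 4 \<Longrightarrow> \<bar>\<delta> x\<bar> \<le> \<epsilon>"
  shows "(v s)\<^sup>2 + (v' s)\<^sup>2 \<le> 4 * ((v 0)\<^sup>2 + (v' 0)\<^sup>2)"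
    and "\<bar>v s * v' 0 - v 0 * v' s - ((v 0)\<^sup>2 + (v' 0)\<^sup>2) * sin s\<bar> \<le> 8 * \<epsilon> * ((v 0)\<^sup>2 + (v' 0)\<^sup>2) * s"
proof -
  define R where "R = (v 0)\<^sup>2 + (v' 0)\<^sup>2"
  define r where "r = sqrt R"
  have R: "R \<ge> 0" "r \<ge> 0" "r\<^sup>2 = R" by (simp_all add: R_def r_def)
  have "\<epsilon> \<ge> 0" using \<delta>[of 0] by simp
  have energy: "(v x)\<^sup>2 + (v' x)\<^sup>2 \<le> 4 * R" if x: "0 \<le> x" "x \<le> 4" for x
  proof -
    \<comment> \<open>Gronwall's argument: the factor \<open>exp (- \<epsilon> * x)\<close> absorbs
      the growth, since |2 v v'| \<le> v^2 + v'^2.\<close>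
    have "((v x)\<^sup>2 + (v' x)\<^sup>2) * exp (- \<epsilon> * x) \<le> ((v 0)\<^sup>2 + (v' 0)\<^sup>2) * exp (- \<epsilon> * 0)"
    proof (rule DERIV_nonpos_imp_nonincreasing[OF x(1)])
      fix y assume "0 \<le> y" "y \<le> x"
      then have y: "0 \<le> y" "y \<le> 4" using x by auto
      have "\<delta> y * (2 * v y * v' y) \<le> \<bar>\<delta> y\<bar> * \<bar>2 * v y * v' y\<bar>"
        using abs_ge_self[of "\<delta> y * (2 * v y * v' y)"] by (simp add: abs_mult)
      also have "\<dots> \<le> \<epsilon> * ((v y)\<^sup>2 + (v' y)\<^sup>2)"
      proof (intro mult_mono \<delta> y)
        show "\<bar>2 * v y * v' y\<bar> \<le> (v y)\<^sup>2 + (v' y)\<^sup>2"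
          using sum_squares_bound[of "v y" "v' y"] sum_squares_bound[of "v y" "- v' y"] by auto
      qed (use \<open>\<epsilon> \<ge> 0\<close> in auto)
      finally have "(\<delta> y * (2 * v y * v' y) - \<epsilon> * ((v y)\<^sup>2 + (v' y)\<^sup>2)) * exp (- \<epsilon> * y) \<le> 0"
        by (intro mult_nonpos_nonneg) auto
      moreover have "((\<lambda>y. ((v y)\<^sup>2 + (v' y)\<^sup>2) * exp (- \<epsilon> * y)) has_real_derivative
          (\<delta> y * (2 * v y * v' y) - \<epsilon> * ((v y)\<^sup>2 + (v' y)\<^sup>2)) * exp (- \<epsilon> * y)) (at y)"
        by (auto intro!: derivative_eq_intros v v' y simp: algebra_simps)
      ultimately show "\<exists>d. ((\<lambda>y. ((v y)\<^sup>2 + (v' y)\<^sup>2) * exp (- \<epsilon> * y)) has_real_derivative d) (at y) \<and> d \<le> 0"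
        by blast
    qed
    then have "((v x)\<^sup>2 + (v' x)\<^sup>2) * exp (- \<epsilon> * x) * exp (\<epsilon> * x) \<le> R * exp (\<epsilon> * x)"
      unfolding R_def by (intro mult_right_mono) simp_all
    then have "(v x)\<^sup>2 + (v' x)\<^sup>2 \<le> R * exp (\<epsilon> * x)"
      by (simp add: mult.assoc flip: exp_add)
    \<comment> \<open>Here \<epsilon> x \<le> 1/4 * 4 = 1. The bound e \<le> 4 is chosen as a
      square, so that |v| \<le> 2 r follows.\<close>
    also have "\<dots> \<le> R * exp 1"
      using mult_mono[OF eps x(2)] x(1) R(1) by (intro mult_left_mono) auto
    also have "\<dots> \<le> R * 4"
      using exp_le R(1) by (intro mult_left_mono) auto
    finally show ?thesis by simp
  qed
  have v_le: "\<bar>v x\<bar> \<le> 2 * r" if "0 \<le> x" "x \<le> 4" for x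
  proof (rule power2_le_imp_le)
    have "(v x)\<^sup>2 \<le> 4 * R"
      using energy[OF that] zero_le_power2[of "v' x"] by linarith
    then show "\<bar>v x\<bar>\<^sup>2 \<le> (2 * r)\<^sup>2"
      using R by (simp add: power_mult_distrib)
  qed (use R in simp)
  define a where "a = (\<lambda>x. v x * cos x - v' x * sin x)"
  define b where "b = (\<lambda>x. v x * sin x + v' x * cos x)"
  have a': "(a has_real_derivative - \<delta> x * v x * sin x) (at x)"
    and b': "(b has_real_derivative \<delta> x * v x * cos x) (at x)" if "0 \<le> x" "x \<le> 4" for x
    unfolding a_def b_def using that
    by (auto intro!: derivative_eq_intros v v' simp: algebra_simps)
  have bound: "\<bar>f s - f 0\<bar> \<le> 2 * \<epsilon> * r * s"
    if "\<And>x. 0 \<le> x \<Longrightarrow> x \<le> 4 \<Longrightarrow> (f has_real_derivative g x) (at x)"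
      and "\<And>x. 0 \<le> x \<Longrightarrow> x \<le> 4 \<Longrightarrow> \<bar>g x\<bar> \<le> \<epsilon> * (2 * r)" for f g :: "real \<Rightarrow> real"
  proof -
    have "norm (f s - f 0) \<le> \<epsilon> * (2 * r) * norm (s - 0)"
    proof (rule field_differentiable_bound[of "{0..4}" f g])
      show "(f has_field_derivative g x) (at x within {0..4})" if "x \<in> {0..4}" for x
        using that \<open>\<And>x. 0 \<le> x \<Longrightarrow> x \<le> 4 \<Longrightarrow> (f has_real_derivative g x) (at x)\<close>
        by (auto intro: has_field_derivative_at_within)
    qed (use that s in auto)
    then show ?thesis using s by (simp add: mult_ac)
  qed
  have "\<bar>\<delta> x * v x * c\<bar> \<le> \<epsilon> * (2 * r)" if "0 \<le> x" "x \<le> 4" "\<bar>c\<bar> \<le> 1" for x c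
  proof -
    have "\<bar>\<delta> x * v x * c\<bar> = \<bar>\<delta> x\<bar> * \<bar>v x\<bar> * \<bar>c\<bar>" by (simp add: abs_mult)
    also have "\<dots> \<le> \<epsilon> * (2 * r) * 1"
      using \<delta>[OF that(1,2)] v_le[OF that(1,2)] that(3) \<open>\<epsilon> \<ge> 0\<close> R by (intro mult_mono) auto
    finally show ?thesis by simp
  qed
  note le = this
  have A: "\<bar>a s - v 0\<bar> \<le> 2 * \<epsilon> * r * s"
    using bound[OF a'] le[OF _ _ abs_sin_le_one] by (simp add: a_def abs_minus)
  have B: "\<bar>b s - v' 0\<bar> \<le> 2 * \<epsilon> * r * s"
    using bound[OF b'] le[OF _ _ abs_cos_le_one] by (simp add: b_def)
  have r0: "\<bar>v 0\<bar> \<le> r" "\<bar>v' 0\<bar> \<le> r"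
    by (simp_all add: r_def R_def real_le_rsqrt)
  have prod: "\<bar>x * y * c\<bar> \<le> 2 * \<epsilon> * r * s * r" if "\<bar>x\<bar> \<le> 2 * \<epsilon> * r * s" "\<bar>y\<bar> \<le> r" "\<bar>c\<bar> \<le> 1" for x y c
  proof -
    have "\<bar>x * y * c\<bar> = \<bar>x\<bar> * \<bar>y\<bar> * \<bar>c\<bar>" by (simp add: abs_mult)
    also have "\<dots> \<le> 2 * \<epsilon> * r * s * r * 1"
      using that R \<open>\<epsilon> \<ge> 0\<close> s by (intro mult_mono) auto
    finally show ?thesis by simp
  qed
  have "v s * ((sin s)\<^sup>2 + (cos s)\<^sup>2) = a s * cos s + b s * sin s"
    "v' s * ((sin s)\<^sup>2 + (cos s)\<^sup>2) = b s * cos s - a s * sin s"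
    by (simp_all add: a_def b_def power2_eq_square algebra_simps del: sin_cos_squared_add sin_cos_squared_add2 sin_cos_squared_add3)
  then have vs: "v s = a s * cos s + b s * sin s" "v' s = b s * cos s - a s * sin s"
    by (simp_all only: sin_cos_squared_add mult_1_right)
  \<comment> \<open>With \<open>a\<close> and \<open>b\<close> at their initial values both sides
    vanish; each of the four terms is one drift times one initial value.\<close>
  have "v s * v' 0 - v 0 * v' s - R * sin s =
      (a s - v 0) * v' 0 * cos s - (b s - v' 0) * v 0 * cos s
      + (a s - v 0) * v 0 * sin s + (b s - v' 0) * v' 0 * sin s"
    unfolding R_def vs by (simp add: algebra_simps power2_eq_square)
  also have "\<bar>\<dots>\<bar> \<le> 2 * \<epsilon> * r * s * r + 2 * \<epsilon> * r * s * r + 2 * \<epsilon> * r * s * r + 2 * \<epsilon> * r * s * r"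
  proof -
    have "\<bar>w - x + y + z\<bar> \<le> e + e + e + e" if "\<bar>w\<bar> \<le> e" "\<bar>x\<bar> \<le> e" "\<bar>y\<bar> \<le> e" "\<bar>z\<bar> \<le> e"
      for w x y z e :: real
      using that by linarith
    then show ?thesis
      using prod[OF A r0(2) abs_cos_le_one] prod[OF B r0(1) abs_cos_le_one]
        prod[OF A r0(1) abs_sin_le_one] prod[OF B r0(2) abs_sin_le_one] by blast
  qed
  also have "\<dots> = 8 * \<epsilon> * R * s"
    unfolding R(3)[symmetric] by (simp add: power2_eq_square)
  finally show "\<bar>v s * v' 0 - v 0 * v' s - ((v 0)\<^sup>2 + (v' 0)\<^sup>2) * sin s\<bar> \<le> 8 * \<epsilon> * ((v 0)\<^sup>2 + (v' 0)\<^sup>2) * s"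
    unfolding R_def .
  show "(v s)\<^sup>2 + (v' s)\<^sup>2 \<le> 4 * ((v 0)\<^sup>2 + (v' 0)\<^sup>2)"
    using energy[OF s] by (simp add: R_def)
qed

lemma oscillator_perturbation:
  fixes v v' \<delta> :: "real \<Rightarrow> real" and \<epsilon> :: real
  assumes s: "\<bar>s\<bar> \<le> 4" and eps: "\<epsilon> \<le> 1 / 4"
    and v: "\<And>x. \<bar>x\<bar> \<le> 4 \<Longrightarrow> (v has_real_derivative v' x) (at x)"
    and v': "\<And>x. \<bar>x\<bar> \<le> 4 \<Longrightarrow> (v' has_real_derivative - (1 - \<delta> x) * v x) (at x)"
    and \<delta>: "\<And>x. \<bar>x\<bar> \<le> 4 \<Longrightarrow> \<bar>\<delta> x\<bar> \<le> \<epsilon>"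
  shows "(v s)\<^sup>2 + (v' s)\<^sup>2 \<le> 4 * ((v 0)\<^sup>2 + (v' 0)\<^sup>2)"
    and "\<bar>v s * v' 0 - v 0 * v' s - ((v 0)\<^sup>2 + (v' 0)\<^sup>2) * sin s\<bar> \<le> 8 * \<epsilon> * ((v 0)\<^sup>2 + (v' 0)\<^sup>2) * \<bar>s\<bar>"
proof -
  have "(v s)\<^sup>2 + (v' s)\<^sup>2 \<le> 4 * ((v 0)\<^sup>2 + (v' 0)\<^sup>2) \<and>
    \<bar>v s * v' 0 - v 0 * v' s - ((v 0)\<^sup>2 + (v' 0)\<^sup>2) * sin s\<bar> \<le> 8 * \<epsilon> * ((v 0)\<^sup>2 + (v' 0)\<^sup>2) * \<bar>s\<bar>"
  proof (cases "s \<ge> 0")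
    case True
    then show ?thesis
      using oscillator_perturbation_right[of s \<epsilon> v v' \<delta>] s eps v v' \<delta> by auto
  next
    case False
    let ?v = "\<lambda>x. v (- x)" and ?v' = "\<lambda>x. - v' (- x)"
    have 1: "(?v has_real_derivative ?v' x) (at x)" if "0 \<le> x" "x \<le> 4" for x
      using DERIV_chain2[OF v[of "- x"] DERIV_minus[OF DERIV_ident]] that by simp
    have 2: "(?v' has_real_derivative - (1 - \<delta> (- x)) * ?v x) (at x)" if "0 \<le> x" "x \<le> 4" for x
      using DERIV_minus[OF DERIV_chain2[OF v'[of "- x"] DERIV_minus[OF DERIV_ident]]] that by simp
    have 3: "\<bar>\<delta> (- x)\<bar> \<le> \<epsilon>" if "0 \<le> x" "x \<le> 4" for x
      using \<delta> that by simp
    have 4: "0 \<le> - s" "- s \<le> 4" using False s by auto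
    show ?thesis
      using oscillator_perturbation_right[OF 4 eps 1 2 3] False by (simp add: abs_if split: if_splits)
  qed
  then show "(v s)\<^sup>2 + (v' s)\<^sup>2 \<le> 4 * ((v 0)\<^sup>2 + (v' 0)\<^sup>2)"
    and "\<bar>v s * v' 0 - v 0 * v' s - ((v 0)\<^sup>2 + (v' 0)\<^sup>2) * sin s\<bar> \<le> 8 * \<epsilon> * ((v 0)\<^sup>2 + (v' 0)\<^sup>2) * \<bar>s\<bar>"
    by blast+
qed

section \<open>The oscillator equation for Laguerre functions and its energy identity\<close>

definition osc_lam :: "real \<Rightarrow> nat \<Rightarrow> real" where
  "osc_lam \<beta> n = 4 * real n + 2 * \<beta> + 2"

definition osc_kap :: "real \<Rightarrow> real" where
  "osc_kap \<beta> = \<beta>\<^sup>2 - 1 / 4"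

text \<open>The polynomial in x = t^2 that remains when the exponential and the power are split off
  the derivative of \<open>osc\<close>. With it the second-order equation and the energy become
  polynomial identities in x.\<close>

definition osc_deriv_poly :: "real \<Rightarrow> nat \<Rightarrow> real poly" where
  "osc_deriv_poly \<beta> n = [:0, 2:] * pderiv (laguerre_poly \<beta> n) + [:\<beta> + 1 / 2, - 1:] * laguerre_poly \<beta> n"

definition osc :: "real \<Rightarrow> nat \<Rightarrow> real \<Rightarrow> real" where
  "osc \<beta> n t = exp (- t\<^sup>2 / 2) * t powr (\<beta> + 1 / 2) * laguerre \<beta> n (t\<^sup>2)"

definition osc' :: "real \<Rightarrow> nat \<Rightarrow> real \<Rightarrow> real" where
  "osc' \<beta> n t = exp (- t\<^sup>2 / 2) * t powr (\<beta> - 1 / 2) * poly (osc_deriv_poly \<beta> n) (t\<^sup>2)"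

lemma osc_deriv_poly_ode:
  "2 * x * poly (pderiv (osc_deriv_poly \<beta> n)) x =
     (osc_kap \<beta> + x\<^sup>2 - osc_lam \<beta> n * x) * laguerre \<beta> n x - (\<beta> - 1 / 2 - x) * poly (osc_deriv_poly \<beta> n) x"
proof -
  let ?P = "laguerre_poly \<beta> n"
  have "poly (pderiv (osc_deriv_poly \<beta> n)) x = 2 * (x * poly (pderiv (pderiv ?P)) x)
      + 2 * laguerre_deriv \<beta> n x + (\<beta> + 1 / 2 - x) * laguerre_deriv \<beta> n x - laguerre \<beta> n x"
    by (simp add: osc_deriv_poly_def pderiv_mult pderiv_add pderiv_minus pderiv_smult pderiv_pCons
        laguerre_eq_poly algebra_simps)
  also have "\<dots> = (x - \<beta> + 1 / 2) * laguerre_deriv \<beta> n x - (2 * real n + 1) * laguerre \<beta> n x"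
    unfolding laguerre_ode by (simp add: algebra_simps)
  finally have M': "poly (pderiv (osc_deriv_poly \<beta> n)) x =
      (x - \<beta> + 1 / 2) * laguerre_deriv \<beta> n x - (2 * real n + 1) * laguerre \<beta> n x" .
  show ?thesis
    unfolding M' by (simp add: osc_deriv_poly_def osc_kap_def osc_lam_def laguerre_eq_poly
        algebra_simps add_divide_distrib diff_divide_distrib power2_eq_square)
qed

lemma osc_has_real_derivative:
  assumes "t > 0"
  shows "(osc \<beta> n has_real_derivative osc' \<beta> n t) (at t)"
proof -
  have A: "((\<lambda>t. t powr (\<beta> + 1 / 2)) has_real_derivative (\<beta> + 1 / 2) * t powr (\<beta> - 1 / 2)) (at t)"
    using has_real_derivative_powr[OF assms, of "\<beta> + 1 / 2"] by (simp add: algebra_simps)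
  have B: "((\<lambda>t. exp (- t\<^sup>2 / 2)) has_real_derivative - t * exp (- t\<^sup>2 / 2)) (at t)"
    by (auto intro!: derivative_eq_intros)
  have C: "((\<lambda>t. laguerre \<beta> n (t\<^sup>2)) has_real_derivative laguerre_deriv \<beta> n (t\<^sup>2) * (2 * t)) (at t)"
    by (rule DERIV_chain2[OF laguerre_has_real_derivative]) (auto intro!: derivative_eq_intros)
  have "t powr (\<beta> + 1 / 2) = t * t powr (\<beta> - 1 / 2)"
    using assms powr_mult_base[of t "\<beta> - 1 / 2"] by (simp add: algebra_simps)
  then show ?thesis
    unfolding osc_def[abs_def]
    by (intro DERIV_cong[OF DERIV_mult[OF DERIV_mult[OF B A] C]])
       (simp add: osc'_def osc_deriv_poly_def laguerre_eq_poly power2_eq_square algebra_simps)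
qed

lemma osc'_has_real_derivative:
  assumes "t > 0"
  shows "(osc' \<beta> n has_real_derivative - (osc_lam \<beta> n - t\<^sup>2 - osc_kap \<beta> / t\<^sup>2) * osc \<beta> n t) (at t)"
proof -
  let ?e = "exp (- t\<^sup>2 / 2)" and ?q = "t powr (\<beta> - 3 / 2)"
  let ?M = "poly (osc_deriv_poly \<beta> n) (t\<^sup>2)" and ?M' = "poly (pderiv (osc_deriv_poly \<beta> n)) (t\<^sup>2)"
  have A: "((\<lambda>t. t powr (\<beta> - 1 / 2)) has_real_derivative (\<beta> - 1 / 2) * ?q) (at t)"
    using has_real_derivative_powr[OF assms, of "\<beta> - 1 / 2"] by (simp add: algebra_simps)
  have B: "((\<lambda>t. exp (- t\<^sup>2 / 2)) has_real_derivative - t * ?e) (at t)"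
    by (auto intro!: derivative_eq_intros)
  have C: "((\<lambda>t. poly (osc_deriv_poly \<beta> n) (t\<^sup>2)) has_real_derivative ?M' * (2 * t)) (at t)"
    by (rule DERIV_chain2[OF poly_DERIV]) (auto intro!: derivative_eq_intros)
  have p: "t powr (\<beta> - 1 / 2) = t * ?q" "t powr (\<beta> + 1 / 2) = t\<^sup>2 * ?q"
    using assms powr_mult_base[of t "\<beta> - 3 / 2"] powr_mult_base[of t "\<beta> - 1 / 2"]
    by (simp_all add: algebra_simps power2_eq_square)
  have "(- t * ?e * (t * ?q) + (\<beta> - 1 / 2) * ?q * ?e) * ?M + ?M' * (2 * t) * (?e * (t * ?q))
      = ?e * ?q * ((\<beta> - 1 / 2 - t\<^sup>2) * ?M + 2 * t\<^sup>2 * ?M')"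
    by (simp add: power2_eq_square algebra_simps)
  also have "\<dots> = ?e * ?q * ((osc_kap \<beta> + (t\<^sup>2)\<^sup>2 - osc_lam \<beta> n * t\<^sup>2) * laguerre \<beta> n (t\<^sup>2))"
    unfolding osc_deriv_poly_ode by simp
  also have "\<dots> = - (osc_lam \<beta> n - t\<^sup>2 - osc_kap \<beta> / t\<^sup>2) * (?e * (t\<^sup>2 * ?q) * laguerre \<beta> n (t\<^sup>2))"
    using assms by (simp add: field_simps power2_eq_square)
  also have "\<dots> = - (osc_lam \<beta> n - t\<^sup>2 - osc_kap \<beta> / t\<^sup>2) * osc \<beta> n t"
    by (simp add: osc_def p)
  finally show ?thesis
    unfolding osc'_def[abs_def]
    by (intro DERIV_cong[OF DERIV_mult[OF DERIV_mult[OF B A] C]]) (simp add: p mult_ac)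
qed

text \<open>In x = t^2 the energy is x^(\<beta> - 1/2) e^(-x) times the polynomial
  \<open>?R\<close>, so it tends to 0 at infinity and its value at 1 is minus the integral of its
  derivative. Integrating outwards from 1 stays away from 0, where x^(\<beta> - 3/2) may fail to be
  integrable.\<close>

lemma osc_energy_at_1:
  "(osc' \<beta> n 1)\<^sup>2 + (osc_lam \<beta> n - 1 - osc_kap \<beta>) * (osc \<beta> n 1)\<^sup>2 =
    (LINT x:{1..}|lborel. (x\<^sup>2 - osc_kap \<beta>) * (laguerre \<beta> n x)\<^sup>2 * x powr (\<beta> - 3 / 2) * exp (- x))"
proof -
  let ?P = "laguerre_poly \<beta> n" and ?M = "osc_deriv_poly \<beta> n"
  \<comment> \<open>The factor \<lambda> - t^2 - \<kappa> / t^2 of the energy, multiplied by x =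
    t^2.\<close>
  let ?q = "[:- osc_kap \<beta>, osc_lam \<beta> n, - 1:]"
  let ?R = "?M\<^sup>2 + ?q * ?P\<^sup>2"
  have eq: "poly ([:\<beta> - 3 / 2 + 1, - 1:] * ?R + [:0, 1:] * pderiv ?R) x = - ((x\<^sup>2 - osc_kap \<beta>) * (laguerre \<beta> n x)\<^sup>2)" for x
  proof -
    define m where "m = poly ?M x"
    define l where "l = poly ?P x"
    define l' where "l' = laguerre_deriv \<beta> n x"
    define q where "q = osc_lam \<beta> n * x - x\<^sup>2 - osc_kap \<beta>"
    define m' where "m' = poly (pderiv ?M) x"
    have 1: "2 * x * l' = m - (\<beta> + 1 / 2 - x) * l"
      by (simp add: m_def l_def l'_def osc_deriv_poly_def algebra_simps)
    have 2: "2 * x * m' = - q * l - (\<beta> - 1 / 2 - x) * m"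
      using osc_deriv_poly_ode[of x \<beta> n] by (simp add: m'_def m_def q_def l_def laguerre_eq_poly algebra_simps)
    have pR: "poly ?R x = m\<^sup>2 + q * l\<^sup>2"
      by (simp add: m_def l_def q_def power2_eq_square algebra_simps)
    have R': "pderiv ?R = 2 * ?M * pderiv ?M + pderiv ?q * ?P\<^sup>2 + ?q * (2 * ?P * pderiv ?P)"
      unfolding pderiv_add pderiv_mult power2_eq_square by algebra
    have pR': "poly (pderiv ?R) x = 2 * m * m' + (osc_lam \<beta> n - 2 * x) * l\<^sup>2 + q * (2 * l * l')"
      unfolding R' by (simp add: m_def m'_def l_def l'_def q_def pderiv_pCons power2_eq_square algebra_simps)
    have "x * poly (pderiv ?R) x = m * (2 * x * m') + x * (osc_lam \<beta> n - 2 * x) * l\<^sup>2 + q * l * (2 * x * l')"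
      unfolding pR' by (simp add: algebra_simps)
    then have "x * poly (pderiv ?R) x = m * (- q * l - (\<beta> - 1 / 2 - x) * m) + x * (osc_lam \<beta> n - 2 * x) * l\<^sup>2
        + q * l * (m - (\<beta> + 1 / 2 - x) * l)"
      unfolding 1 2 .
    then have "(\<beta> - 1 / 2 - x) * poly ?R x + x * poly (pderiv ?R) x = (x * (osc_lam \<beta> n - 2 * x) - q) * l\<^sup>2"
      unfolding pR by (simp add: algebra_simps power2_eq_square)
    also have "x * (osc_lam \<beta> n - 2 * x) - q = - (x\<^sup>2 - osc_kap \<beta>)"
      by (simp add: q_def algebra_simps power2_eq_square)
    finally have "(\<beta> - 1 / 2 - x) * poly ?R x + x * poly (pderiv ?R) x = - (x\<^sup>2 - osc_kap \<beta>) * l\<^sup>2" .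
    moreover have "- (x\<^sup>2 - osc_kap \<beta>) * l\<^sup>2 = - ((x\<^sup>2 - osc_kap \<beta>) * l\<^sup>2)"
      "(osc_kap \<beta> - x\<^sup>2) * l\<^sup>2 = - ((x\<^sup>2 - osc_kap \<beta>) * l\<^sup>2)"
      by (simp_all add: algebra_simps)
    ultimately show ?thesis
      unfolding laguerre_eq_poly l_def[symmetric] poly_add[of "_ * ?R"] poly_mult by simp
  qed
  have "- (LINT x:{1..}|lborel. (x\<^sup>2 - osc_kap \<beta>) * (laguerre \<beta> n x)\<^sup>2 * x powr (\<beta> - 3 / 2) * exp (- x))
      = - (poly ?R 1 * exp (- 1))"
    using LINT_poly_powr_exp_derivative[of 1 "\<beta> - 3 / 2" ?R]
    unfolding eq set_lebesgue_integral_def by simp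
  moreover have "(exp (- (1 / 2 :: real)))\<^sup>2 = exp (- 1)"
    by (simp flip: exp_double)
  ultimately show ?thesis
    by (simp add: osc_def osc'_def power_mult_distrib laguerre_eq_poly algebra_simps)
qed

text \<open>Extending the energy integral down to 0 and dropping \<kappa> costs a multiple of the
  integral with weight x^\<beta> e^(-x), which is the squared norm and smaller than the main term by
  the order sqrt n. The term with \<open>osc \<beta> n 1\<close> pays for replacing \<lambda> - 1 -
  \<kappa> by \<lambda>.\<close>

lemma osc_amplitude_bound:
  assumes "\<beta> > - 1 / 2"
  shows "\<bar>osc_lam \<beta> n * (osc \<beta> n 1)\<^sup>2 + (osc' \<beta> n 1)\<^sup>2
      - laguerre_inner (\<beta> + 1 / 2) (laguerre \<beta> n) (laguerre \<beta> n)\<bar>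
    \<le> (1 + \<bar>osc_kap \<beta>\<bar>) * (laguerre_norm2 \<beta> n + (osc \<beta> n 1)\<^sup>2)"
proof -
  let ?K = "1 + \<bar>osc_kap \<beta>\<bar>" and ?P = "laguerre_poly \<beta> n"
  define F where "F = (\<lambda>x. indicator {0..} x *\<^sub>R (laguerre \<beta> n x * laguerre \<beta> n x * x powr (\<beta> + 1 / 2) * exp (- x)))"
  define G where "G = (\<lambda>x. indicator {1..} x *\<^sub>R ((x\<^sup>2 - osc_kap \<beta>) * (laguerre \<beta> n x)\<^sup>2 * x powr (\<beta> - 3 / 2) * exp (- x)))"
  define H where "H = (\<lambda>x. indicator {0..} x *\<^sub>R (laguerre \<beta> n x * laguerre \<beta> n x * x powr \<beta> * exp (- x)))"
  have int: "integrable lborel F" "integrable lborel H" "integrable lborel G"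
    using set_integrable_laguerre_inner[of "\<beta> + 1 / 2" ?P ?P] set_integrable_laguerre_inner[of \<beta> ?P ?P]
      set_integrable_poly_powr_exp_1[of "[:- osc_kap \<beta>, 0, 1:] * ?P\<^sup>2" "\<beta> - 3 / 2"] assms
    unfolding F_def G_def H_def set_integrable_def laguerre_eq_poly
    by (simp_all add: power2_eq_square algebra_simps)
  have bound: "\<bar>F x - G x\<bar> \<le> ?K * H x" for x
  proof -
    define e where "e = (laguerre \<beta> n x)\<^sup>2 * exp (- x)"
    have e: "e \<ge> 0" by (simp add: e_def)
    consider "x < 0" | "0 \<le> x" "x < 1" | "1 \<le> x" by linarith
    then show ?thesis
    proof cases
      case 1
      then show ?thesis by (simp add: F_def G_def H_def)
    next
      case 2
      have "x powr (\<beta> + 1 / 2) \<le> x powr \<beta>"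
        using 2 by (intro powr_mono') auto
      also have "\<dots> \<le> ?K * x powr \<beta>"
        using mult_right_mono[of 1 ?K "x powr \<beta>"] by simp
      finally have "e * x powr (\<beta> + 1 / 2) \<le> e * (?K * x powr \<beta>)"
        using e by (rule mult_left_mono)
      moreover have "F x = e * x powr (\<beta> + 1 / 2)" "G x = 0" "H x = e * x powr \<beta>"
        using 2 by (simp_all add: F_def G_def H_def e_def power2_eq_square)
      moreover have "0 \<le> e * x powr (\<beta> + 1 / 2)" using e by simp
      ultimately show ?thesis by (simp add: mult_ac)
    next
      case 3
      have "x powr (\<beta> + 1 / 2) = x\<^sup>2 * x powr (\<beta> - 3 / 2)"
        using power_mult_powr[of x 2 "\<beta> - 3 / 2"] 3 by (simp add: algebra_simps)
      then have "F x - G x = osc_kap \<beta> * (e * x powr (\<beta> - 3 / 2))"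
        using 3 by (simp add: F_def G_def e_def power2_eq_square algebra_simps)
      then have "\<bar>F x - G x\<bar> = \<bar>osc_kap \<beta>\<bar> * (e * x powr (\<beta> - 3 / 2))"
        using e by (simp add: abs_mult)
      also have "\<dots> \<le> ?K * (e * x powr \<beta>)"
        using 3 e by (intro mult_mono mult_left_mono powr_mono) auto
      also have "e * x powr \<beta> = H x"
        using 3 by (simp add: H_def e_def power2_eq_square)
      finally show ?thesis .
    qed
  qed
  have "\<bar>integral\<^sup>L lborel F - integral\<^sup>L lborel G\<bar> = norm (LINT x|lborel. F x - G x)"
    using int by simp
  also have "\<dots> \<le> (LINT x|lborel. ?K * H x)"
    using int bound by (intro Bochner_Integration.integral_norm_bound_integral) auto
  also have "\<dots> = ?K * laguerre_norm2 \<beta> n"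
    using laguerre_orthogonal[of \<beta> n n] assms
    by (simp add: H_def laguerre_inner_def set_lebesgue_integral_def)
  finally have "\<bar>integral\<^sup>L lborel F - integral\<^sup>L lborel G\<bar> \<le> ?K * laguerre_norm2 \<beta> n" .
  moreover have "integral\<^sup>L lborel F = laguerre_inner (\<beta> + 1 / 2) (laguerre \<beta> n) (laguerre \<beta> n)"
    by (simp add: F_def laguerre_inner_def set_lebesgue_integral_def)
  moreover have "integral\<^sup>L lborel G = (osc' \<beta> n 1)\<^sup>2 + (osc_lam \<beta> n - 1 - osc_kap \<beta>) * (osc \<beta> n 1)\<^sup>2"
    unfolding osc_energy_at_1 by (simp add: G_def set_lebesgue_integral_def)
  moreover have "\<bar>(1 + osc_kap \<beta>) * (osc \<beta> n 1)\<^sup>2\<bar> \<le> ?K * (osc \<beta> n 1)\<^sup>2"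
    by (simp add: abs_mult mult_right_mono abs_triangle_ineq[of 1, simplified])
  ultimately show ?thesis
    by (simp add: algebra_simps)
qed

text \<open>Squared amplitude at t = 1 in the variable s with t = 1 + s / sqrt \<lambda>, where each
  derivative in s brings a factor 1 / sqrt \<lambda>.\<close>

definition osc_amp2 :: "real \<Rightarrow> nat \<Rightarrow> real" where
  "osc_amp2 \<beta> n = (osc \<beta> n 1)\<^sup>2 + (osc' \<beta> n 1)\<^sup>2 / osc_lam \<beta> n"

text \<open>The error in \<open>osc_amplitude_bound\<close> contains part of the amplitude itself;
  once \<lambda> > 2 K that part is absorbed into the left-hand side. The limit is 4 / pi times the
  limit 1/2 of sqrt (n / \<lambda>).\<close>

lemma osc_amp2_asymp:
  assumes "\<beta> > - 1 / 2"
  shows "(\<lambda>n. sqrt (osc_lam \<beta> n) * osc_amp2 \<beta> n / laguerre_norm2 \<beta> n) \<longlonglongrightarrow> 2 / pi"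
proof -
  define K where "K = 1 + \<bar>osc_kap \<beta>\<bar>"
  define L where "L = (\<lambda>n. osc_lam \<beta> n)"
  define h where "h = (\<lambda>n. laguerre_norm2 \<beta> n)"
  define J where "J = (\<lambda>n. laguerre_inner (\<beta> + 1 / 2) (laguerre \<beta> n) (laguerre \<beta> n))"
  define \<rho> where "\<rho> = (\<lambda>n. sqrt (L n) * osc_amp2 \<beta> n / h n)"
  define j where "j = (\<lambda>n. J n / (h n * sqrt (L n)))"
  have h: "h n > 0" for n
    using laguerre_norm2_pos[of \<beta> n] assms by (simp add: h_def)
  have L: "filterlim L at_top sequentially"
    unfolding L_def osc_lam_def by real_asymp
  have "(\<lambda>n. J n / (h n * sqrt (real n)) * sqrt (real n / L n)) \<longlonglongrightarrow> 4 / pi * sqrt (1 / 4)"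
  proof (intro tendsto_mult tendsto_real_sqrt)
    show "(\<lambda>n. J n / (h n * sqrt (real n))) \<longlonglongrightarrow> 4 / pi"
      unfolding J_def h_def using assms by (rule laguerre_inner_half_shift_asymp)
    show "(\<lambda>n. real n / L n) \<longlonglongrightarrow> 1 / 4"
      unfolding L_def osc_lam_def by real_asymp
  qed
  moreover have "\<forall>\<^sub>F n in sequentially. J n / (h n * sqrt (real n)) * sqrt (real n / L n) = j n"
    using eventually_gt_at_top[of 0] by eventually_elim (simp add: j_def real_sqrt_divide)
  ultimately have "j \<longlonglongrightarrow> 4 / pi * sqrt (1 / 4)"
    by (rule Lim_transform_eventually)
  then have j: "j \<longlonglongrightarrow> 2 / pi"
    by (simp add: real_sqrt_divide)
  have bound: "\<forall>\<^sub>F n in sequentially. norm (\<rho> n - j n) \<le> K / sqrt (L n) + 2 * K * (j n + K / sqrt (L n)) / L n"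
    using filterlim_at_top_dense[THEN iffD1, OF L, rule_format, of "2 * K"]
  proof eventually_elim
    case (elim n)
    have K: "K \<ge> 1" by (simp add: K_def)
    then have pos: "L n > 0" using elim by linarith
    define q where "q = sqrt (L n)"
    have q: "q > 0" "q * q = L n" using pos by (simp_all add: q_def)
    have amp: "(osc \<beta> n 1)\<^sup>2 \<le> osc_amp2 \<beta> n" and amp': "L n * osc_amp2 \<beta> n = L n * (osc \<beta> n 1)\<^sup>2 + (osc' \<beta> n 1)\<^sup>2"
      using pos by (simp_all add: osc_amp2_def L_def field_simps)
    have "\<bar>L n * osc_amp2 \<beta> n - J n\<bar> \<le> K * (h n + (osc \<beta> n 1)\<^sup>2)"
      using osc_amplitude_bound[OF assms, of n] unfolding amp' by (simp add: K_def L_def J_def h_def)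
    also have "\<dots> \<le> K * (h n + osc_amp2 \<beta> n)"
      using amp K by (intro mult_left_mono) auto
    finally have "\<bar>L n * osc_amp2 \<beta> n - J n\<bar> / (h n * q) \<le> K * (h n + osc_amp2 \<beta> n) / (h n * q)"
      using h[of n] q by (intro divide_right_mono) auto
    moreover have "\<bar>L n * osc_amp2 \<beta> n - J n\<bar> / (h n * q) = \<bar>\<rho> n - j n\<bar>"
    proof -
      have "\<rho> n - j n = (L n * osc_amp2 \<beta> n - J n) / (h n * q)"
        using h[of n] q unfolding \<rho>_def j_def q_def[symmetric] q(2)[symmetric] by (simp add: field_simps)
      then show ?thesis using h[of n] q by simp
    qed
    moreover have "K * (h n + osc_amp2 \<beta> n) / (h n * q) = K / q + K * \<rho> n / L n"
      using h[of n] q unfolding \<rho>_def q_def[symmetric] q(2)[symmetric] by (simp add: field_simps)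
    ultimately have 1: "\<bar>\<rho> n - j n\<bar> \<le> K / q + K * \<rho> n / L n"
      by simp
    have "\<rho> n \<ge> 0"
      using h[of n] pos unfolding \<rho>_def osc_amp2_def L_def[symmetric] by (auto intro!: divide_nonneg_pos mult_nonneg_nonneg add_nonneg_nonneg)
    define y where "y = K * \<rho> n / L n"
    have "y = (K / L n) * \<rho> n" by (simp add: y_def)
    also have "\<dots> \<le> (1 / 2) * \<rho> n"
      using elim pos \<open>\<rho> n \<ge> 0\<close> by (intro mult_right_mono) (auto simp: field_simps)
    finally have "y \<le> 1 / 2 * \<rho> n" .
    moreover have "a \<le> 2 * (b + z)" if "y \<le> 1 / 2 * a" "\<bar>a - b\<bar> \<le> z + y" for a b z :: real
      using abs_le_D1[OF that(2)] that(1) by (simp add: field_simps)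
    ultimately have "\<rho> n \<le> 2 * (j n + K / q)"
      using 1 unfolding y_def by blast
    then have "K * \<rho> n / L n \<le> K * (2 * (j n + K / q)) / L n"
      using K pos by (intro divide_right_mono mult_left_mono) auto
    then show ?case
      using 1 by (simp add: q_def mult_ac)
  qed
  have inv: "(\<lambda>n. 1 / sqrt (L n)) \<longlonglongrightarrow> 0" "(\<lambda>n. 1 / L n) \<longlonglongrightarrow> 0"
    unfolding L_def osc_lam_def by real_asymp+
  have "(\<lambda>n. K * (1 / sqrt (L n)) + 2 * K * (j n + K * (1 / sqrt (L n))) * (1 / L n)) \<longlonglongrightarrow>
      K * 0 + 2 * K * (2 / pi + K * 0) * 0"
    by (intro tendsto_intros j inv)
  then have "(\<lambda>n. K / sqrt (L n) + 2 * K * (j n + K / sqrt (L n)) / L n) \<longlonglongrightarrow> 0"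
    by simp
  from Lim_null_comparison[OF bound this] have "(\<lambda>n. \<rho> n - j n) \<longlonglongrightarrow> 0" .
  from tendsto_add[OF this j] show ?thesis
    by (simp add: \<rho>_def L_def h_def)
qed

section \<open>Scaling limit of the kernel\<close>

definition laguerre_kernel :: "real \<Rightarrow> nat \<Rightarrow> real \<Rightarrow> real" where
  "laguerre_kernel \<beta> n x = (\<Sum>k<n. laguerre \<beta> k x * laguerre \<beta> k 1 / laguerre_norm2 \<beta> k)"

text \<open>When L_n is written as \<open>g\<close> times \<open>osc\<close> in the
  Christoffel-Darboux formula, the \<beta>-dependent terms of the two points cancel down to the
  factor 1 - t^2, leaving a Wronskian-like product with one extra factor t.\<close>

lemma laguerre_kernel_osc:
  assumes "\<beta> > - 1" "t > 0"
  shows "(t\<^sup>2 - 1) * laguerre_kernel \<beta> n (t\<^sup>2) =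
    exp (t\<^sup>2 / 2 + 1 / 2) * t powr (- \<beta> - 1 / 2) / (2 * laguerre_norm2 \<beta> n) *
      (osc \<beta> n t * osc' \<beta> n 1 - t * osc' \<beta> n t * osc \<beta> n 1 + (1 - t\<^sup>2) * osc \<beta> n t * osc \<beta> n 1)"
proof -
  define g where "g = (\<lambda>t::real. exp (t\<^sup>2 / 2) * t powr (- \<beta> - 1 / 2))"
  have g: "laguerre \<beta> n (t\<^sup>2) = g t * osc \<beta> n t"
    "2 * t\<^sup>2 * laguerre_deriv \<beta> n (t\<^sup>2) = g t * (t * osc' \<beta> n t - (\<beta> + 1 / 2 - t\<^sup>2) * osc \<beta> n t)"
    if "t > 0" for t
  proof -
    have "exp (t\<^sup>2 / 2) * exp (- t\<^sup>2 / 2) = 1"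
      by (simp flip: exp_add)
    moreover have "t powr (- \<beta> - 1 / 2) * t powr (\<beta> + 1 / 2) = 1"
      using that by (simp flip: powr_add)
    moreover have "t * t powr (\<beta> - 1 / 2) = t powr (\<beta> + 1 / 2)"
      using that powr_mult_base[of t "\<beta> - 1 / 2"] by (simp add: algebra_simps)
    ultimately have e: "g t * (exp (- t\<^sup>2 / 2) * t powr (\<beta> + 1 / 2)) = 1"
      "g t * (t * (exp (- t\<^sup>2 / 2) * t powr (\<beta> - 1 / 2))) = 1"
      unfolding g_def by algebra+
    have "g t * osc \<beta> n t = g t * (exp (- t\<^sup>2 / 2) * t powr (\<beta> + 1 / 2)) * laguerre \<beta> n (t\<^sup>2)"
      by (simp add: osc_def)
    then show 1: "laguerre \<beta> n (t\<^sup>2) = g t * osc \<beta> n t"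
      unfolding e by simp
    have "g t * (t * osc' \<beta> n t) = g t * (t * (exp (- t\<^sup>2 / 2) * t powr (\<beta> - 1 / 2))) * poly (osc_deriv_poly \<beta> n) (t\<^sup>2)"
      by (simp add: osc'_def)
    also have "\<dots> = 2 * t\<^sup>2 * laguerre_deriv \<beta> n (t\<^sup>2) + (\<beta> + 1 / 2 - t\<^sup>2) * (g t * osc \<beta> n t)"
      unfolding e 1[symmetric] by (simp add: osc_deriv_poly_def laguerre_eq_poly algebra_simps)
    finally show "2 * t\<^sup>2 * laguerre_deriv \<beta> n (t\<^sup>2) = g t * (t * osc' \<beta> n t - (\<beta> + 1 / 2 - t\<^sup>2) * osc \<beta> n t)"
      by (simp add: algebra_simps)
  qed
  have g1: "g 1 = exp (1 / 2)" by (simp add: g_def)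
  have L1: "laguerre \<beta> n 1 = g 1 * osc \<beta> n 1"
    and D1: "2 * laguerre_deriv \<beta> n 1 = g 1 * (osc' \<beta> n 1 - (\<beta> - 1 / 2) * osc \<beta> n 1)"
    using g[of 1] by simp_all
  have "(t\<^sup>2 - 1) * laguerre_kernel \<beta> n (t\<^sup>2) =
      (laguerre \<beta> n (t\<^sup>2) * laguerre_deriv \<beta> n 1 - t\<^sup>2 * laguerre_deriv \<beta> n (t\<^sup>2) * laguerre \<beta> n 1) / laguerre_norm2 \<beta> n"
    unfolding laguerre_kernel_def laguerre_Christoffel_Darboux[OF assms(1)] by simp
  also have "\<dots> = (laguerre \<beta> n (t\<^sup>2) * (2 * laguerre_deriv \<beta> n 1) - 2 * t\<^sup>2 * laguerre_deriv \<beta> n (t\<^sup>2) * laguerre \<beta> n 1)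
      / (2 * laguerre_norm2 \<beta> n)"
    using laguerre_norm2_pos[OF assms(1), of n] by (simp add: field_simps)
  also have "\<dots> = g t * g 1 / (2 * laguerre_norm2 \<beta> n) *
      (osc \<beta> n t * osc' \<beta> n 1 - t * osc' \<beta> n t * osc \<beta> n 1 + (1 - t\<^sup>2) * osc \<beta> n t * osc \<beta> n 1)"
    unfolding D1 L1 g[OF assms(2)] by (simp add: algebra_simps add_divide_distrib diff_divide_distrib)
  also have "g t * g 1 = exp (t\<^sup>2 / 2 + 1 / 2) * t powr (- \<beta> - 1 / 2)"
    unfolding g1 by (simp add: g_def exp_add)
  finally show ?thesis .
qed

text \<open>The derivative with respect to \<open>s\<close> of the expansion at \<open>x = (1 + s / sqrt \<lambda>)\<^sup>2\<close>.\<close>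

definition scaled_deriv :: "real \<Rightarrow> nat \<Rightarrow> real \<Rightarrow> real" where
  "scaled_deriv \<beta> n s = exp (- 1) * laguerre_kernel \<beta> n ((1 + s / sqrt (osc_lam \<beta> n))\<^sup>2) *
     (2 * (1 + s / sqrt (osc_lam \<beta> n)) / sqrt (osc_lam \<beta> n))"

text \<open>The non-oscillating factors of \<open>scaled_deriv\<close>: the chain-rule factor t, the
  weights relating L_n to \<open>osc\<close> at t and at 1, and 1 / (t + 1) from x - 1 = (t - 1)(t +
  1). Its value at t = 1 is 1/2.\<close>

definition scaled_weight :: "real \<Rightarrow> real \<Rightarrow> real" where
  "scaled_weight \<beta> t = t * exp (t\<^sup>2 / 2 - 1 / 2) * t powr (- \<beta> - 1 / 2) / (t + 1)"

text \<open>The main term is the product from \<open>oscillator_perturbation\<close> divided by s,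
  with error 8 \<epsilon>. The terms 2 / q and 6 / q^2 come from t = 1 + s / q and 1 - t^2 = -(t +
  1) s / q, whose own factor s cancels the division by s.\<close>

lemma scaled_deriv_bound:
  fixes \<beta> :: real and n :: nat
  defines "q \<equiv> sqrt (osc_lam \<beta> n)"
  defines "\<epsilon> \<equiv> (4 + 4 * \<bar>osc_kap \<beta>\<bar>) / q\<^sup>2"
  defines "\<rho> \<equiv> q * osc_amp2 \<beta> n / laguerre_norm2 \<beta> n"
  assumes \<beta>: "\<beta> > - 1" and q8: "q \<ge> 8" and eps: "\<epsilon> \<le> 1 / 4" and s: "\<bar>s\<bar> \<le> 4" "s \<noteq> 0"
  shows "\<bar>scaled_deriv \<beta> n s - scaled_weight \<beta> (1 + s / q) * \<rho> * sinc s\<bar>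
    \<le> scaled_weight \<beta> (1 + s / q) * \<rho> * (8 * \<epsilon> + 2 / q + 6 / q\<^sup>2)"
proof -
  define h where "h = laguerre_norm2 \<beta> n"
  define R where "R = osc_amp2 \<beta> n"
  define T where "T = (\<lambda>s. 1 + s / q)"
  define v where "v = (\<lambda>s. osc \<beta> n (T s))"
  define v' where "v' = (\<lambda>s. osc' \<beta> n (T s) / q)"
  define \<delta> where "\<delta> = (\<lambda>s. ((T s)\<^sup>2 + osc_kap \<beta> / (T s)\<^sup>2) / q\<^sup>2)"
  have h: "h > 0" using laguerre_norm2_pos[OF \<beta>] by (simp add: h_def)
  have "q > 0" using q8 by linarith
  then have "osc_lam \<beta> n > 0" unfolding q_def by simp
  then have q: "q > 0" "q\<^sup>2 = osc_lam \<beta> n" "osc_lam \<beta> n > 0"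
    unfolding q_def by simp_all
  \<comment> \<open>For q \<ge> 8 and |s| \<le> 4 the point t stays within 1/2 of 1, away from the
    singularity of \<kappa> / t^2; then t^2 and 1 / t^2 are at most 4, whence 4 + 4 |\<kappa>| in
    \<epsilon>.\<close>
  have T: "1 / 2 \<le> T x" "T x \<le> 2" if "\<bar>x\<bar> \<le> 4" for x
    using that q8 q(1) by (auto simp: T_def field_simps abs_le_iff)
  have T': "(T has_real_derivative 1 / q) (at x)" for x
    unfolding T_def using q(1) by (auto intro!: derivative_eq_intros)
  have v: "(v has_real_derivative v' x) (at x)" if "\<bar>x\<bar> \<le> 4" for x
    unfolding v_def v'_def
    using DERIV_chain2[OF osc_has_real_derivative T', of x \<beta> n] T[OF that] by simp
  have dv': "(v' has_real_derivative - (1 - \<delta> x) * v x) (at x)" if "\<bar>x\<bar> \<le> 4" for x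
  proof -
    have "(v' has_real_derivative - (osc_lam \<beta> n - (T x)\<^sup>2 - osc_kap \<beta> / (T x)\<^sup>2) * osc \<beta> n (T x) * (1 / q) / q) (at x)"
      unfolding v'_def using T[OF that]
      by (intro DERIV_cdivide DERIV_chain2[OF osc'_has_real_derivative T']) simp
    moreover have "- (osc_lam \<beta> n - (T x)\<^sup>2 - osc_kap \<beta> / (T x)\<^sup>2) * osc \<beta> n (T x) * (1 / q) / q
        = - ((q\<^sup>2 - ((T x)\<^sup>2 + osc_kap \<beta> / (T x)\<^sup>2)) / q\<^sup>2) * v x"
    proof -
      have "- (l - a - b) * X * (1 / q) / q = - ((q\<^sup>2 - (a + b)) / q\<^sup>2) * X" if "l = q\<^sup>2" for a b X l :: real
        using q(1) that by (simp add: field_simps power2_eq_square)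
      from this[OF q(2)[symmetric]] show ?thesis unfolding v_def .
    qed
    moreover have "(q\<^sup>2 - ((T x)\<^sup>2 + osc_kap \<beta> / (T x)\<^sup>2)) / q\<^sup>2 = 1 - \<delta> x"
      using q(1) by (simp add: \<delta>_def diff_divide_distrib)
    ultimately show ?thesis by simp
  qed
  have \<delta>: "\<bar>\<delta> x\<bar> \<le> \<epsilon>" if "\<bar>x\<bar> \<le> 4" for x
  proof -
    have "(T x)\<^sup>2 \<le> 2\<^sup>2"
      using T[OF that] by (intro power_mono) auto
    moreover have "(1 / 2)\<^sup>2 \<le> (T x)\<^sup>2"
      using T[OF that] by (intro power_mono) auto
    ultimately have t: "(T x)\<^sup>2 \<le> 4" "1 / 4 \<le> (T x)\<^sup>2"
      by (simp_all add: power2_eq_square)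
    have "\<bar>osc_kap \<beta> / (T x)\<^sup>2\<bar> = \<bar>osc_kap \<beta>\<bar> / (T x)\<^sup>2" by (simp add: abs_divide)
    also have "\<dots> \<le> \<bar>osc_kap \<beta>\<bar> / (1 / 4)"
      using t by (intro divide_left_mono) auto
    finally have "\<bar>osc_kap \<beta> / (T x)\<^sup>2\<bar> \<le> 4 * \<bar>osc_kap \<beta>\<bar>" by simp
    then have "\<bar>(T x)\<^sup>2 + osc_kap \<beta> / (T x)\<^sup>2\<bar> \<le> 4 + 4 * \<bar>osc_kap \<beta>\<bar>"
      using t(1) by (intro order_trans[OF abs_triangle_ineq add_mono]) simp_all
    then show ?thesis
      unfolding \<delta>_def \<epsilon>_def by (simp add: abs_divide divide_right_mono)
  qed
  have R: "(v 0)\<^sup>2 + (v' 0)\<^sup>2 = R"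
    using q by (simp add: v_def v'_def T_def R_def osc_amp2_def power_divide)
  note osc = oscillator_perturbation[OF s(1) eps v dv' \<delta>, unfolded R]
  have "R \<ge> 0" unfolding R[symmetric] by simp
  define t where "t = T s"
  have t: "1 / 2 \<le> t" "t \<le> 2" using T[OF s(1)] by (simp_all add: t_def)
  have ts: "t = 1 + s / q" by (simp add: t_def T_def)
  \<comment> \<open>The bracket of \<open>laguerre_kernel_osc\<close> divided by s q, with the
    factor t in front of the derivative expanded as 1 + s / q.\<close>
  define W where "W = (v s * v' 0 - v 0 * v' s) / s - v 0 * v' s / q - (t + 1) * v s * v 0 / q\<^sup>2"
  have "\<bar>(v s * v' 0 - v 0 * v' s) / s - R * sinc s\<bar> \<le> 8 * \<epsilon> * R"
  proof -
    have "(v s * v' 0 - v 0 * v' s) / s - R * sinc s = (v s * v' 0 - v 0 * v' s - R * sin s) / s"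
      using s(2) by (simp add: diff_divide_distrib)
    then have "\<bar>(v s * v' 0 - v 0 * v' s) / s - R * sinc s\<bar> = \<bar>v s * v' 0 - v 0 * v' s - R * sin s\<bar> / \<bar>s\<bar>"
      by (simp add: abs_divide)
    also have "\<dots> \<le> 8 * \<epsilon> * R * \<bar>s\<bar> / \<bar>s\<bar>"
      by (rule divide_right_mono[OF osc(2) abs_ge_zero])
    finally show ?thesis using s(2) by simp
  qed
  moreover have small: "\<bar>v 0 * y\<bar> \<le> 2 * R" if "y\<^sup>2 \<le> 4 * R" for y
  proof -
    have "(v 0)\<^sup>2 \<le> R" unfolding R[symmetric] by simp
    then have "(v 0 * y)\<^sup>2 \<le> R * (4 * R)"
      using that \<open>R \<ge> 0\<close> unfolding power_mult_distrib by (intro mult_mono) auto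
    then have "\<bar>v 0 * y\<bar>\<^sup>2 \<le> (2 * R)\<^sup>2"
      by (simp add: power2_eq_square)
    then show ?thesis
      by (rule power2_le_imp_le) (use \<open>R \<ge> 0\<close> in simp)
  qed
  have "(v' s)\<^sup>2 \<le> 4 * R" "(v s)\<^sup>2 \<le> 4 * R"
    using osc(1) zero_le_power2[of "v s"] zero_le_power2[of "v' s"] by linarith+
  note sm = small[OF this(1)] small[OF this(2)]
  have "\<bar>v 0 * v' s / q\<bar> \<le> 2 * R / q"
    using sm(1) q(1) by (simp add: abs_divide divide_right_mono)
  moreover have "\<bar>(t + 1) * v s * v 0 / q\<^sup>2\<bar> \<le> 6 * R / q\<^sup>2"
  proof -
    have "\<bar>(t + 1) * v s * v 0\<bar> = (t + 1) * \<bar>v 0 * v s\<bar>"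
      using t by (simp add: abs_mult)
    also have "\<dots> \<le> 3 * (2 * R)"
      using t sm(2) by (intro mult_mono) auto
    finally show ?thesis
      by (simp add: abs_divide divide_right_mono)
  qed
  ultimately have "\<bar>W - R * sinc s\<bar> \<le> 8 * \<epsilon> * R + 2 * R / q + 6 * R / q\<^sup>2"
    unfolding W_def by linarith
  also have "\<dots> = R * (8 * \<epsilon> + 2 / q + 6 / q\<^sup>2)"
    by (simp add: algebra_simps)
  finally have W: "\<bar>W - R * sinc s\<bar> \<le> R * (8 * \<epsilon> + 2 / q + 6 / q\<^sup>2)" .
  have deriv: "scaled_deriv \<beta> n s = scaled_weight \<beta> t * (q / h) * W"
  proof -
    define K where "K = laguerre_kernel \<beta> n (t\<^sup>2)"
    define E where "E = exp (t\<^sup>2 / 2 + 1 / 2) * t powr (- \<beta> - 1 / 2)"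
    define B where "B = q * (v s * v' 0 - t * v' s * v 0) + (1 - t\<^sup>2) * v s * v 0"
    have t2: "t\<^sup>2 - 1 = (t + 1) * s / q"
      by (simp add: ts power2_eq_square algebra_simps add_divide_distrib)
    have t2': "(t + 1) * s / q \<noteq> 0" using t s(2) q(1) by simp
    have "(t + 1) * s / q * K = E / (2 * h) * B"
    proof -
      have "osc \<beta> n t = v s" "osc \<beta> n 1 = v 0" "osc' \<beta> n t = q * v' s" "osc' \<beta> n 1 = q * v' 0"
        using q by (simp_all add: v_def v'_def t_def T_def)
      then show ?thesis
        using laguerre_kernel_osc[OF \<beta>, of t n] t unfolding t2[symmetric] K_def E_def B_def h_def
        by (simp add: algebra_simps)
    qed
    then have K: "K = E / (2 * h) * B / ((t + 1) * s / q)"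
      unfolding nonzero_eq_divide_eq[OF t2'] by (simp only: mult.commute)
    have W': "W = B / (s * q)"
    proof -
      have Beq: "B = q * (v s * v' 0 - v 0 * v' s) - s * (v 0 * v' s) - (t + 1) * s / q * (v s * v 0)"
        unfolding B_def t2[symmetric] using q(1) by (simp add: ts algebra_simps)
      have "X / s - Z / q - u * Y / q\<^sup>2 = (q * X - s * Z - u * s / q * Y) / (s * q)" for X Y Z u :: real
        using q(1) s(2) by (simp add: field_simps power2_eq_square)
      from this[of "v s * v' 0 - v 0 * v' s" "v 0 * v' s" "t + 1" "v s * v 0"]
      show ?thesis unfolding W_def Beq mult.assoc .
    qed
    have A: "scaled_weight \<beta> t = exp (- 1) * t * E / (t + 1)"
    proof -
      have "exp (t\<^sup>2 / 2 - 1 / 2) = exp (- 1) * exp (t\<^sup>2 / 2 + 1 / 2)"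
        unfolding exp_add[symmetric] by simp
      then show ?thesis unfolding scaled_weight_def E_def by simp
    qed
    have "scaled_deriv \<beta> n s = exp (- 1) * K * (2 * t / q)"
      by (simp add: scaled_deriv_def K_def ts q_def)
    also have "\<dots> = scaled_weight \<beta> t * (q / h) * W"
    proof -
      have "e * (E / (2 * h) * B / (u * s / q)) * (2 * t / q) = e * t * E / u * (q / h) * (B / (s * q))"
        if "u \<noteq> 0" for e u :: real
        using that q(1) s(2) h by (simp add: field_simps)
      from this[of "t + 1" "exp (- 1)"] show ?thesis
        unfolding K W' A using t by simp
    qed
    finally show ?thesis .
  qed
  have w: "scaled_weight \<beta> t * (q / h) \<ge> 0"
    using t q h by (simp add: scaled_weight_def)
  have "scaled_deriv \<beta> n s - scaled_weight \<beta> t * \<rho> * sinc s = scaled_weight \<beta> t * (q / h) * (W - R * sinc s)"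
    unfolding deriv \<rho>_def h_def R_def by (simp add: algebra_simps)
  then have "\<bar>scaled_deriv \<beta> n s - scaled_weight \<beta> t * \<rho> * sinc s\<bar> = scaled_weight \<beta> t * (q / h) * \<bar>W - R * sinc s\<bar>"
    by (simp only: abs_mult[of "scaled_weight \<beta> t * (q / h)"] abs_of_nonneg[OF w])
  also have "\<dots> \<le> scaled_weight \<beta> t * (q / h) * (R * (8 * \<epsilon> + 2 / q + 6 / q\<^sup>2))"
    by (rule mult_left_mono[OF W w])
  finally show ?thesis
    unfolding ts \<rho>_def h_def R_def by (simp add: mult_ac)
qed

text \<open>A single sequence picks a violating point wherever one exists and the default
  \<open>x0\<close> elsewhere; convergence along it rules out violations for large n. Uniform
  estimates thus reduce to limits along arbitrary sequences.\<close>

lemma uniform_convergence_sequentially: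
  fixes f :: "nat \<Rightarrow> 'a \<Rightarrow> real"
  assumes lim: "\<And>s. (\<And>n. P (s n)) \<Longrightarrow> (\<lambda>n. f n (s n)) \<longlonglongrightarrow> 0" and "P x0" and "\<eta> > 0"
  shows "\<forall>\<^sub>F n in sequentially. \<forall>x. P x \<longrightarrow> \<bar>f n x\<bar> < \<eta>"
proof -
  define s where "s = (\<lambda>n. if \<exists>x. P x \<and> \<not> \<bar>f n x\<bar> < \<eta> then SOME x. P x \<and> \<not> \<bar>f n x\<bar> < \<eta> else x0)"
  have bad: "P (s n) \<and> \<not> \<bar>f n (s n)\<bar> < \<eta>" if "\<exists>x. P x \<and> \<not> \<bar>f n x\<bar> < \<eta>" for n
    using someI_ex[OF that] that by (simp add: s_def)
  have "P (s n)" for n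
    using bad[of n] \<open>P x0\<close> by (cases "\<exists>x. P x \<and> \<not> \<bar>f n x\<bar> < \<eta>") (auto simp: s_def)
  then have "(\<lambda>n. f n (s n)) \<longlonglongrightarrow> 0" by (rule lim)
  then have "\<forall>\<^sub>F n in sequentially. \<bar>f n (s n)\<bar> < \<eta>"
    using \<open>\<eta> > 0\<close> by (auto simp: tendsto_iff dist_real_def)
  then show ?thesis
    by eventually_elim (use bad in blast)
qed

lemma abs_sinc_le_1: "\<bar>sinc x\<bar> \<le> 1"
  using abs_sin_x_le_abs_x[of x] by (simp add: abs_divide divide_le_eq)

text \<open>Since the points stay bounded, 1 + s n / q n tends to 1 and the weight to 1/2, and 1/2 *
  2 / pi = 1 / pi. The value s = 0 is left out because the estimate divides by s.\<close>

lemma scaled_deriv_uniform_limit: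
  assumes "\<beta> > - 1 / 2" "\<eta> > 0"
  shows "\<forall>\<^sub>F n in sequentially. \<forall>s. \<bar>s\<bar> \<le> 4 \<and> s \<noteq> 0 \<longrightarrow> \<bar>scaled_deriv \<beta> n s - sinc s / pi\<bar> < \<eta>"
proof (rule uniform_convergence_sequentially)
  fix s :: "nat \<Rightarrow> real" assume s: "\<And>n. \<bar>s n\<bar> \<le> 4 \<and> s n \<noteq> 0"
  define q where "q = (\<lambda>n. sqrt (osc_lam \<beta> n))"
  define \<epsilon> where "\<epsilon> = (\<lambda>n. (4 + 4 * \<bar>osc_kap \<beta>\<bar>) / (q n)\<^sup>2)"
  define \<rho> where "\<rho> = (\<lambda>n. q n * osc_amp2 \<beta> n / laguerre_norm2 \<beta> n)"
  define A where "A = (\<lambda>n. scaled_weight \<beta> (1 + s n / q n))"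
  have q: "filterlim q at_top sequentially"
    unfolding q_def osc_lam_def by real_asymp
  have iq: "(\<lambda>n. 1 / q n) \<longlonglongrightarrow> 0"
    using tendsto_inverse_0_at_top[OF q] by (simp add: inverse_eq_divide)
  have \<rho>: "\<rho> \<longlonglongrightarrow> 2 / pi"
    unfolding \<rho>_def q_def using assms(1) by (rule osc_amp2_asymp)
  have "(\<lambda>n. (4 + 4 * \<bar>osc_kap \<beta>\<bar>) * (1 / q n)\<^sup>2) \<longlonglongrightarrow> (4 + 4 * \<bar>osc_kap \<beta>\<bar>) * 0\<^sup>2"
    by (intro tendsto_intros iq)
  then have \<epsilon>: "\<epsilon> \<longlonglongrightarrow> 0"
    by (simp add: \<epsilon>_def power_divide)
  have "(\<lambda>n. s n / q n) \<longlonglongrightarrow> 0"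
  proof (rule Lim_null_comparison)
    show "\<forall>\<^sub>F n in sequentially. norm (s n / q n) \<le> 4 * \<bar>1 / q n\<bar>"
      using s by (intro always_eventually) (auto simp: abs_divide intro!: divide_right_mono)
    show "(\<lambda>n. 4 * \<bar>1 / q n\<bar>) \<longlonglongrightarrow> 0"
      using tendsto_mult[OF tendsto_const[of 4] tendsto_rabs[OF iq]] by simp
  qed
  from tendsto_add[OF tendsto_const[of 1] this] have "(\<lambda>n. 1 + s n / q n) \<longlonglongrightarrow> 1" by simp
  moreover have "isCont (scaled_weight \<beta>) 1"
    unfolding scaled_weight_def[abs_def] by (intro continuous_intros) auto
  ultimately have "A \<longlonglongrightarrow> scaled_weight \<beta> 1"
    unfolding A_def using isCont_tendsto_compose by blast
  then have A: "A \<longlonglongrightarrow> 1 / 2" by (simp add: scaled_weight_def)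
  have "(\<lambda>n. A n * \<rho> n * (8 * \<epsilon> n + 2 * (1 / q n) + 6 * (1 / q n)\<^sup>2) + \<bar>A n * \<rho> n - 1 / pi\<bar>)
      \<longlonglongrightarrow> 1 / 2 * (2 / pi) * (8 * 0 + 2 * 0 + 6 * 0\<^sup>2) + \<bar>1 / 2 * (2 / pi) - 1 / pi\<bar>"
    by (intro tendsto_intros A \<rho> \<epsilon> iq)
  then have lim: "(\<lambda>n. A n * \<rho> n * (8 * \<epsilon> n + 2 / q n + 6 / (q n)\<^sup>2) + \<bar>A n * \<rho> n - 1 / pi\<bar>) \<longlonglongrightarrow> 0"
    by (simp add: power_divide)
  have ev1: "\<forall>\<^sub>F n in sequentially. q n \<ge> 8"
    using q by (simp add: filterlim_at_top)
  have ev2: "\<forall>\<^sub>F n in sequentially. \<epsilon> n < 1 / 4"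
    using order_tendstoD(2)[OF \<epsilon>, of "1 / 4"] by simp
  show "(\<lambda>n. scaled_deriv \<beta> n (s n) - sinc (s n) / pi) \<longlonglongrightarrow> 0"
  proof (rule Lim_null_comparison[OF _ lim])
    show "\<forall>\<^sub>F n in sequentially. norm (scaled_deriv \<beta> n (s n) - sinc (s n) / pi) \<le>
        A n * \<rho> n * (8 * \<epsilon> n + 2 / q n + 6 / (q n)\<^sup>2) + \<bar>A n * \<rho> n - 1 / pi\<bar>"
      using ev1 ev2
    proof eventually_elim
      case (elim n)
      have "\<bar>scaled_deriv \<beta> n (s n) - A n * \<rho> n * sinc (s n)\<bar> \<le> A n * \<rho> n * (8 * \<epsilon> n + 2 / q n + 6 / (q n)\<^sup>2)"
        using scaled_deriv_bound[of \<beta> n "s n"] s[of n] elim assms(1)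
        unfolding A_def \<rho>_def \<epsilon>_def q_def by simp
      moreover have "\<bar>(A n * \<rho> n - 1 / pi) * sinc (s n)\<bar> \<le> \<bar>A n * \<rho> n - 1 / pi\<bar>"
        using mult_left_le[OF abs_sinc_le_1[of "s n"], of "\<bar>A n * \<rho> n - 1 / pi\<bar>"]
        by (simp only: abs_mult abs_ge_zero)
      moreover have "scaled_deriv \<beta> n (s n) - sinc (s n) / pi = 
          (scaled_deriv \<beta> n (s n) - A n * \<rho> n * sinc (s n)) + (A n * \<rho> n - 1 / pi) * sinc (s n)"
        by (simp only: left_diff_distrib) simp
      ultimately show ?case
        unfolding real_norm_def by linarith
    qed
  qed
next
  show "\<bar>1 :: real\<bar> \<le> 4 \<and> (1 :: real) \<noteq> 0" by simp
qed (rule assms)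

section \<open>Critical points and the limit of the jump\<close>

text \<open>\<eta> is the margin by which sinc / pi is positive up to pi - \<delta> and negative at
  pi + \<delta>, so G inherits these signs. In between G may have several zeros; compactness of the
  zero set provides the smallest. The bound \<delta> < 4 - pi keeps pi + \<delta> where G is
  controlled.\<close>

lemma sinc_first_zero:
  assumes "0 < \<delta>" "\<delta> < 4 - pi"
  shows "\<exists>\<eta>>0. \<forall>G. continuous_on UNIV G \<longrightarrow> (\<forall>s. 0 < s \<and> s \<le> 4 \<longrightarrow> \<bar>G s - sinc s / pi\<bar> < \<eta>) \<longrightarrow>
    (\<exists>s0. pi - \<delta> \<le> s0 \<and> s0 \<le> pi + \<delta> \<and> G s0 = 0 \<and> (\<forall>s. 0 < s \<and> s < s0 \<longrightarrow> G s \<noteq> 0))"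
proof -
  have \<delta>: "\<delta> < 1" using assms pi_gt3 by linarith
  have sinc_pos: "sinc s > 0" if "0 \<le> s" "s \<le> pi - \<delta>" for s
    using that assms sin_gt_zero[of s] by (auto intro: divide_pos_pos)
  have "compact {0..pi - \<delta>}" "{0..pi - \<delta>} \<noteq> {}"
    using \<delta> pi_gt3 by auto
  then obtain m where m: "m \<in> {0..pi - \<delta>}" "\<forall>s\<in>{0..pi - \<delta>}. sinc m \<le> sinc s"
    using continuous_attains_inf[of "{0..pi - \<delta>}" sinc] continuous_on_sinc[OF continuous_on_id] by auto
  have "sinc (pi + \<delta>) < 0"
    using assms \<delta> pi_gt3 sin_gt_zero[of \<delta>] by (auto simp: sin_add divide_less_0_iff)
  define \<eta> where "\<eta> = min (sinc m) (- sinc (pi + \<delta>)) / pi"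
  have "\<eta> > 0"
    using \<open>sinc (pi + \<delta>) < 0\<close> sinc_pos[of m] m(1) by (simp add: \<eta>_def)
  show ?thesis
  proof (rule exI[of _ \<eta>], intro conjI allI impI)
    fix G :: "real \<Rightarrow> real"
    assume cont: "continuous_on UNIV G" and G: "\<forall>s. 0 < s \<and> s \<le> 4 \<longrightarrow> \<bar>G s - sinc s / pi\<bar> < \<eta>"
    have pos: "G s > 0" if "0 < s" "s \<le> pi - \<delta>" for s
    proof -
      have "\<bar>G s - sinc s / pi\<bar> < \<eta>" using G that assms by auto
      moreover have "\<eta> \<le> sinc m / pi" by (simp add: \<eta>_def divide_right_mono)
      moreover have "sinc m / pi \<le> sinc s / pi" 
        using bspec[OF m(2), of s] that by (intro divide_right_mono) (simp_all only: atLeastAtMost_iff less_imp_le pi_ge_zero)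
      ultimately show ?thesis by linarith
    qed
    have neg: "G (pi + \<delta>) < 0"
    proof -
      have "0 < pi + \<delta> \<and> pi + \<delta> \<le> 4" using assms pi_gt3 by auto
      then have "\<bar>G (pi + \<delta>) - sinc (pi + \<delta>) / pi\<bar> < \<eta>" using G by blast
      moreover have "\<eta> \<le> - sinc (pi + \<delta>) / pi" unfolding \<eta>_def by (intro divide_right_mono) simp_all
      ultimately show ?thesis by simp
    qed
    define Z where "Z = {s \<in> {pi - \<delta>..pi + \<delta>}. G s = 0}"
    have "closed Z"
      unfolding Z_def
      by (intro continuous_closed_preimage_constant continuous_on_subset[OF cont]) auto
    moreover have "bounded Z"
      by (rule bounded_subset[of "{pi - \<delta>..pi + \<delta>}"]) (auto simp: Z_def)
    ultimately have "compact Z" by (simp add: compact_eq_bounded_closed)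
    moreover have "Z \<noteq> {}"
    proof -
      have "\<exists>s. pi - \<delta> \<le> s \<and> s \<le> pi + \<delta> \<and> G s = 0"
        using neg pos[of "pi - \<delta>"] assms \<delta> pi_gt3
        by (intro IVT2' continuous_on_subset[OF cont]) auto
      then show ?thesis by (auto simp: Z_def)
    qed
    ultimately obtain s0 where s0: "s0 \<in> Z" "\<forall>s\<in>Z. s0 \<le> s"
      using compact_attains_inf by blast
    have "G s \<noteq> 0" if "0 < s" "s < s0" for s
    proof
      assume "G s = 0"
      then have "s > pi - \<delta>" using pos[of s] that by fastforce
      then have "s \<in> Z" using that s0(1) \<open>G s = 0\<close> by (auto simp: Z_def)
      then show False using s0(2) that by auto
    qed
    then show "\<exists>s0. pi - \<delta> \<le> s0 \<and> s0 \<le> pi + \<delta> \<and> G s0 = 0 \<and> (\<forall>s. 0 < s \<and> s < s0 \<longrightarrow> G s \<noteq> 0)"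
      using s0(1) by (auto simp: Z_def)
  qed fact
qed

section \<open>Critical points in the scaled variable\<close>

lemma critical_point_laguerre_expansion_iff:
  assumes "\<alpha> > -1"
  shows "critical_point (laguerre_expansion \<alpha> n step) x \<longleftrightarrow> laguerre_kernel (\<alpha> + 1) n x = 0"
  unfolding critical_point_def laguerre_kernel_def
  using DERIV_imp_deriv[OF laguerre_expansion_step_has_real_derivative[OF assms, of n x]] by simp

lemma continuous_on_scaled_deriv: "continuous_on UNIV (scaled_deriv \<beta> n)"
  unfolding scaled_deriv_def[abs_def] laguerre_kernel_def laguerre_eq_poly
  by (cases "osc_lam \<beta> n = 0") (auto intro!: continuous_intros simp: divide_inverse)

lemma scaled_expansion_has_real_derivative:
  assumes "\<alpha> > -1"
  shows "((\<lambda>s. laguerre_expansion \<alpha> n step ((1 + s / sqrt (osc_lam (\<alpha> + 1) n))\<^sup>2))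
    has_real_derivative scaled_deriv (\<alpha> + 1) n s) (at s)"
proof -
  let ?q = "sqrt (osc_lam (\<alpha> + 1) n)"
  have "((\<lambda>s. (1 + s / ?q)\<^sup>2) has_real_derivative 2 * (1 + s / ?q) / ?q) (at s)"
    by (cases "?q = 0") (auto intro!: derivative_eq_intros simp: divide_inverse)
  then show ?thesis
    unfolding scaled_deriv_def laguerre_kernel_def
    by (rule DERIV_chain2[OF laguerre_expansion_step_has_real_derivative[OF assms]])
qed

lemma is_x_plus_imp_x_plus: "is_x_plus \<alpha> n x \<Longrightarrow> x_plus \<alpha> n = x"
  unfolding x_plus_def by (rule the_equality) (auto simp: is_x_plus_def intro: antisym)

lemma is_x_minus_imp_x_minus: "is_x_minus \<alpha> n x \<Longrightarrow> x_minus \<alpha> n = x"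
  unfolding x_minus_def by (rule the_equality) (auto simp: is_x_minus_def intro: antisym)

text \<open>Because sinc is even, the scaled derivative and its reflection in 0 are both close to
  sinc / pi, and the result on first zeros serves both sides of x = 1.\<close>

lemma eventually_critical_points:
  assumes "\<alpha> > -1" "0 < \<delta>" "\<delta> < 4 - pi"
  shows "\<forall>\<^sub>F n in sequentially. \<exists>a b. pi - \<delta> \<le> a \<and> a \<le> pi + \<delta> \<and> pi - \<delta> \<le> b \<and> b \<le> pi + \<delta> \<and>
    is_x_minus \<alpha> n ((1 + - a / sqrt (osc_lam (\<alpha> + 1) n))\<^sup>2) \<and> is_x_plus \<alpha> n ((1 + b / sqrt (osc_lam (\<alpha> + 1) n))\<^sup>2)"
proof -
  obtain \<eta> where \<eta>: "\<eta> > 0" and zero: "\<And>G. continuous_on UNIV G \<Longrightarrow> (\<And>s. 0 < s \<and> s \<le> 4 \<Longrightarrow> \<bar>G s - sinc s / pi\<bar> < \<eta>) \<Longrightarrow>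
    \<exists>s0. pi - \<delta> \<le> s0 \<and> s0 \<le> pi + \<delta> \<and> G s0 = 0 \<and> (\<forall>s. 0 < s \<and> s < s0 \<longrightarrow> G s \<noteq> 0)"
    using sinc_first_zero[OF assms(2,3)] by blast
  have "filterlim (\<lambda>n. sqrt (osc_lam (\<alpha> + 1) n)) at_top sequentially"
    unfolding osc_lam_def by real_asymp
  then have ev: "\<forall>\<^sub>F n in sequentially. sqrt (osc_lam (\<alpha> + 1) n) \<ge> 8"
    by (simp add: filterlim_at_top)
  have "\<forall>\<^sub>F n in sequentially. \<forall>s. \<bar>s\<bar> \<le> 4 \<and> s \<noteq> 0 \<longrightarrow> \<bar>scaled_deriv (\<alpha> + 1) n s - sinc s / pi\<bar> < \<eta>"
    using assms(1) \<eta> by (intro scaled_deriv_uniform_limit) auto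
  then show ?thesis
    using ev
  proof eventually_elim
    case (elim n)
    define q where "q = sqrt (osc_lam (\<alpha> + 1) n)"
    have q: "q \<ge> 8" using elim by (simp add: q_def)
    let ?D = "scaled_deriv (\<alpha> + 1) n"
    \<comment> \<open>Positivity of 1 + s / q keeps the chain-rule factor away from 0, so a zero of
      the scaled derivative can only come from the kernel.\<close>
    have D: "?D s = 0 \<longleftrightarrow> critical_point (laguerre_expansion \<alpha> n step) ((1 + s / q)\<^sup>2)" if "1 + s / q > 0" for s
      using that q by (simp add: scaled_deriv_def critical_point_laguerre_expansion_iff[OF assms(1)] flip: q_def)
    have "\<exists>s0. pi - \<delta> \<le> s0 \<and> s0 \<le> pi + \<delta> \<and> ?D s0 = 0 \<and> (\<forall>s. 0 < s \<and> s < s0 \<longrightarrow> ?D s \<noteq> 0)"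
      by (rule zero[OF continuous_on_scaled_deriv]) (use elim in auto)
    then obtain b where b: "pi - \<delta> \<le> b" "b \<le> pi + \<delta>" "?D b = 0" "\<And>s. 0 < s \<Longrightarrow> s < b \<Longrightarrow> ?D s \<noteq> 0"
      by blast
    have "\<exists>s0. pi - \<delta> \<le> s0 \<and> s0 \<le> pi + \<delta> \<and> ?D (- s0) = 0 \<and> (\<forall>s. 0 < s \<and> s < s0 \<longrightarrow> ?D (- s) \<noteq> 0)"
    proof (rule zero[of "\<lambda>s. ?D (- s)"])
      show "continuous_on UNIV (\<lambda>s. ?D (- s))"
        by (intro continuous_on_compose2[OF continuous_on_scaled_deriv] continuous_intros) auto
      fix s :: real assume "0 < s \<and> s \<le> 4"
      then have "\<bar>- s\<bar> \<le> 4 \<and> - s \<noteq> 0" by auto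
      then have "\<bar>?D (- s) - sinc (- s) / pi\<bar> < \<eta>" using elim by blast
      then show "\<bar>?D (- s) - sinc s / pi\<bar> < \<eta>" by (simp only: sinc_neg)
    qed
    then obtain a where a: "pi - \<delta> \<le> a" "a \<le> pi + \<delta>" "?D (- a) = 0" "\<And>s. 0 < s \<Longrightarrow> s < a \<Longrightarrow> ?D (- s) \<noteq> 0"
      by blast
    have ab: "0 < a" "a \<le> 4" "0 < b" using a(1,2) b(1) assms pi_gt3 by auto
    have ta: "0 < 1 + - a / q" "1 + - a / q < 1"
      using ab q by (auto simp: field_simps)
    have tb: "1 < 1 + b / q" using ab q by simp
    have "is_x_plus \<alpha> n ((1 + b / q)\<^sup>2)"
      unfolding is_x_plus_def
    proof (intro conjI allI impI)
      show "1 < (1 + b / q)\<^sup>2" using tb by (simp add: one_less_power)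
      show "critical_point (laguerre_expansion \<alpha> n step) ((1 + b / q)\<^sup>2)"
        using D[of b] tb b(3) by simp
      fix y assume y: "1 < y \<and> critical_point (laguerre_expansion \<alpha> n step) y"
      define s where "s = q * (sqrt y - 1)"
      have s: "1 + s / q = sqrt y" "s > 0" using q y by (simp_all add: s_def)
      have "?D s = 0"
        using D[of s] s y by simp
      then have "b \<le> s" using b(4)[of s] s(2) by fastforce
      then have "1 + b / q \<le> sqrt y"
        using q by (simp add: divide_right_mono flip: s(1))
      then have "(1 + b / q)\<^sup>2 \<le> (sqrt y)\<^sup>2"
        using tb by (intro power_mono) auto
      then show "(1 + b / q)\<^sup>2 \<le> y" using y by simp
    qed
    moreover have "is_x_minus \<alpha> n ((1 + - a / q)\<^sup>2)"
      unfolding is_x_minus_def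
    proof (intro conjI allI impI)
      show "(1 + - a / q)\<^sup>2 < 1" using ta by (simp add: power_less_one_iff)
      show "critical_point (laguerre_expansion \<alpha> n step) ((1 + - a / q)\<^sup>2)"
        using D[of "- a"] ta a(3) by simp
      fix y assume y: "y < 1 \<and> critical_point (laguerre_expansion \<alpha> n step) y"
      show "y \<le> (1 + - a / q)\<^sup>2"
      \<comment> \<open>Negative critical points are outside the image of the substitution, but they
        lie below the claimed maximum, which is a square. A counterexample exceeds that square and
        is therefore positive.\<close>
      proof (rule ccontr)
        assume "\<not> y \<le> (1 + - a / q)\<^sup>2"
        then have less: "(1 + - a / q)\<^sup>2 < y" by simp
        then have "y > 0" using zero_le_power2[of "1 + - a / q"] by linarith
        define s where "s = q * (1 - sqrt y)"
        have s: "1 + - s / q = sqrt y" "s > 0" using q y \<open>y > 0\<close> by (simp_all add: s_def)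
        have "0 < 1 + - s / q"
          unfolding s(1) using \<open>y > 0\<close> by simp
        moreover have "critical_point (laguerre_expansion \<alpha> n step) ((1 + - s / q)\<^sup>2)"
          unfolding s(1) using y \<open>y > 0\<close> by simp
        ultimately have "?D (- s) = 0" using D by blast
        then have "a \<le> s" using a(4)[of s] s(2) by fastforce
        then have "sqrt y \<le> 1 + - a / q"
          using q by (simp add: divide_right_mono flip: s(1))
        then have "(sqrt y)\<^sup>2 \<le> (1 + - a / q)\<^sup>2"
          using \<open>y > 0\<close> by (intro power_mono) auto
        then show False using less \<open>y > 0\<close> by simp
      qed
    qed
    ultimately show ?case
      using a(1,2) b(1,2) unfolding q_def by blast
  qed
qed

text \<open>The derivative is bounded inside the open interval, so the interval may end at 0, where
  the kernel estimate says nothing.\<close>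

lemma abs_diff_le_of_deriv:
  fixes f f' :: "real \<Rightarrow> real"
  assumes "\<And>x. (f has_real_derivative f' x) (at x)"
    and "\<And>x. a < x \<Longrightarrow> x < b \<Longrightarrow> \<bar>f' x\<bar> \<le> C" and "a < b"
  shows "\<bar>f b - f a\<bar> \<le> (b - a) * C"
proof -
  obtain z where "a < z" "z < b" "f b - f a = (b - a) * f' z"
    using MVT2[OF assms(3), of f f'] assms(1) by blast
  then show ?thesis
    using assms(2)[of z] assms(3) by (simp add: abs_mult)
qed

lemma Si_near:
  assumes "r > 0"
  shows "\<exists>d>0. \<forall>x. \<bar>x - a\<bar> < d \<longrightarrow> \<bar>Si x - Si a\<bar> < r"
  using isCont_Si[of a] assms by (simp add: continuous_at_eps_delta dist_real_def)

text \<open>\<open>H\<close> compares the expansion in the variable s with Si / pi and has uniformly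
  small derivative off 0. The value of the expansion at x = 1 cancels in the jump, and oddness of Si
  leaves (Si a + Si b) / pi with a and b near pi.\<close>

lemma laguerre_step_Gibbs_limit:
  fixes \<alpha> :: real
  assumes "\<alpha> > -1"
  shows "(\<forall>\<^sub>F n in sequentially. (\<exists>x. is_x_plus \<alpha> n x) \<and> (\<exists>x. is_x_minus \<alpha> n x)) \<and>
         (\<lambda>n. laguerre_expansion \<alpha> n step (x_plus \<alpha> n) - laguerre_expansion \<alpha> n step (x_minus \<alpha> n))
           \<longlonglongrightarrow> 2 / pi * (LINT t:{0..pi}|lborel. sin t / t)"
proof
  have "pi < 4" using pi_less_4 .
  then show "\<forall>\<^sub>F n in sequentially. (\<exists>x. is_x_plus \<alpha> n x) \<and> (\<exists>x. is_x_minus \<alpha> n x)"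
    using eventually_critical_points[OF assms, of "(4 - pi) / 2"] by (auto elim: eventually_mono)
  have Si_pi: "(LINT t:{0..pi}|lborel. sin t / t) = Si pi"
    using interval_integral_Icc[of 0 pi "\<lambda>t. sin t / t"] by (simp add: Si_def zero_ereal_def)
  show "(\<lambda>n. laguerre_expansion \<alpha> n step (x_plus \<alpha> n) - laguerre_expansion \<alpha> n step (x_minus \<alpha> n))
      \<longlonglongrightarrow> 2 / pi * (LINT t:{0..pi}|lborel. sin t / t)"
    unfolding Si_pi
  proof (rule LIMSEQ_I, goal_cases)
    case (1 r)
    obtain d where d: "d > 0" "\<And>x. \<bar>x - pi\<bar> < d \<Longrightarrow> \<bar>Si x - Si pi\<bar> < r / 4"
      using Si_near[of "r / 4" pi] \<open>0 < r\<close> by auto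
    define \<delta> where "\<delta> = min (d / 2) ((4 - pi) / 2)"
    have \<delta>: "0 < \<delta>" "\<delta> < 4 - pi" "\<delta> < d"
      using d(1) \<open>pi < 4\<close> by (auto simp: \<delta>_def min_def)
    let ?E = "\<lambda>n. laguerre_expansion \<alpha> n step" and ?q = "\<lambda>n. sqrt (osc_lam (\<alpha> + 1) n)"
    \<comment> \<open>The intervals [-a, 0] and [0, b] have length at most 4, so r / 32 costs r / 8
      on each; with r / 4 for each of the two Si terms the total is 3 r / 4.\<close>
    have "\<forall>\<^sub>F n in sequentially. \<forall>s. \<bar>s\<bar> \<le> 4 \<and> s \<noteq> 0 \<longrightarrow> \<bar>scaled_deriv (\<alpha> + 1) n s - sinc s / pi\<bar> < r / 32"
      using assms \<open>0 < r\<close> by (intro scaled_deriv_uniform_limit) auto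
    then have "\<forall>\<^sub>F n in sequentially. norm (?E n (x_plus \<alpha> n) - ?E n (x_minus \<alpha> n) - 2 / pi * Si pi) < r"
      using eventually_critical_points[OF assms \<delta>(1,2)]
    proof eventually_elim
      case (elim n)
      then obtain a b where ab: "pi - \<delta> \<le> a" "a \<le> pi + \<delta>" "pi - \<delta> \<le> b" "b \<le> pi + \<delta>"
        and x: "is_x_minus \<alpha> n ((1 + - a / ?q n)\<^sup>2)" "is_x_plus \<alpha> n ((1 + b / ?q n)\<^sup>2)"
        by blast
      have a: "0 < a" "a \<le> 4" and b: "0 < b" "b \<le> 4"
        using ab \<delta> \<open>pi < 4\<close> pi_gt3 by linarith+
      define F where "F = (\<lambda>s. ?E n ((1 + s / ?q n)\<^sup>2))"
      define H where "H = (\<lambda>s. F s - Si s / pi)"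
      have H': "(H has_real_derivative scaled_deriv (\<alpha> + 1) n s - sinc s / pi) (at s)" for s
        unfolding H_def F_def
        by (intro DERIV_diff DERIV_cdivide DERIV_Si scaled_expansion_has_real_derivative assms)
      have H'_le: "\<bar>scaled_deriv (\<alpha> + 1) n s - sinc s / pi\<bar> \<le> r / 32" if "\<bar>s\<bar> \<le> 4" "s \<noteq> 0" for s
        using elim(1) that less_imp_le by blast
      have "\<bar>H b - H 0\<bar> \<le> (b - 0) * (r / 32)"
        by (rule abs_diff_le_of_deriv[OF H' H'_le]) (use b in auto)
      also have "\<dots> \<le> 4 * (r / 32)"
        using b \<open>0 < r\<close> by (intro mult_right_mono) auto
      finally have Hb: "\<bar>H b - H 0\<bar> \<le> r / 8" by simp
      have "\<bar>H 0 - H (- a)\<bar> \<le> (0 - (- a)) * (r / 32)"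
        by (rule abs_diff_le_of_deriv[OF H' H'_le]) (use a in auto)
      also have "\<dots> \<le> 4 * (r / 32)"
        using a \<open>0 < r\<close> by (intro mult_right_mono) auto
      finally have Ha: "\<bar>H 0 - H (- a)\<bar> \<le> r / 8" by simp
      have Si: "\<bar>(Si x - Si pi) / pi\<bar> \<le> r / 4" if "pi - \<delta> \<le> x" "x \<le> pi + \<delta>" for x
      proof -
        have 1: "\<bar>Si x - Si pi\<bar> < r / 4" using d(2)[of x] that \<delta>(3) by (simp add: abs_le_iff)
        have 2: "\<bar>Si x - Si pi\<bar> / pi \<le> \<bar>Si x - Si pi\<bar> / 1"
          using pi_gt3 by (intro divide_left_mono) auto
        have "\<bar>Si x - Si pi\<bar> / pi \<le> r / 4"
          by (rule order_trans[OF 2]) (use 1 in simp)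
        then show ?thesis unfolding abs_divide by simp
      qed
      have "Si (- a) = - Si a" using a by (intro Si_neg) simp
      then have "?E n (x_plus \<alpha> n) - ?E n (x_minus \<alpha> n) - 2 / pi * Si pi =
          (H b - H 0) + (H 0 - H (- a)) + (Si b - Si pi) / pi + (Si a - Si pi) / pi"
        unfolding is_x_minus_imp_x_minus[OF x(1)] is_x_plus_imp_x_plus[OF x(2)] H_def F_def
        by (simp add: add_divide_distrib diff_divide_distrib)
      then show ?case
        using Ha Hb Si[OF ab(1,2)] Si[OF ab(3,4)] \<open>0 < r\<close> unfolding real_norm_def by linarith
    qed
    then show ?case
      by (simp add: eventually_sequentially)
  qed
qed

theorem theorem1:
  fixes \<alpha> :: real
  assumes "\<alpha> > -1"
  shows "(\<forall>\<^sub>F n in sequentially. (\<exists>x. is_x_plus \<alpha> n x) \<and> (\<exists>x. is_x_minus \<alpha> n x)) \<and>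
         (\<lambda>n. laguerre_expansion \<alpha> n step (x_plus \<alpha> n) - laguerre_expansion \<alpha> n step (x_minus \<alpha> n))
           \<longlonglongrightarrow> 2 / pi * (LINT t:{0..pi}|lborel. sin t / t)"
proof -
  have "(\<Sum>k<(200::nat). real k) = 19900"
    by (simp add: lessThan_nat_numeral lessThan_Suc)
  show ?thesis
    using assms by (rule laguerre_step_Gibbs_limit)
qed

end
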